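(* For real $\nu>-1$ let $\varphi_\nu(z)=2^{\nu}\Gamma(\nu+1)z^{1-\nu}J_\nu(z)$, where $J_\nu$ is the Bessel function of the first kind of order $\nu$, and let $r^\star(\varphi_\nu)$ be its radius of starlikeness. Then, as $\nu\to+\infty$ through real values, \[ r^\star(\varphi_\nu)\sim\sqrt{2\nu}\left(1+\sum_{k=1}^\infty\frac{\pi_k}{\nu^k}\right)=\sqrt{2\nu}\left(1+\frac{1}{4\nu}+\frac{7}{32\nu^2}-\frac{39}{128\nu^3}-\frac{405}{2048\nu^4}+\cdots\right), \] where the coefficients $\pi_k$ ($k\ge1$) are given by the recurrence relation \[ \pi_k=\frac12\rho_k-\frac12\sum_{n=1}^{k-1}\pi_n\pi_{k-n}, \] and the numbers $\rho_k$ ($k\ge1$) are determined recursively by \[ \rho_k=(-1)^{k+1}-\sum_{n=1}^{k-1}(-1)^{k-n}\rho_n-\sum_{n=2}^{k+1}2^{n+1}\sum_{m=0}^{k-n+1}\sigma^{(n)}_{k-n-m+1}\,\mathsf{A}_{n,m}(\rho_1,\rho_2,\ldots,\rho_m). \]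
   Context: The function $\varphi_\nu$ is understood as the entire function $\varphi_\nu(z)=z\sum_{j\ge0}\frac{(-1)^j (z^2/4)^j}{j!\,(\nu+1)_j}$ with $(a)_j=a(a+1)\cdots(a+j-1)$; it satisfies $\varphi_\nu(0)=0$, $\varphi_\nu'(0)=1$. For a function $f$ with $f(0)=0$, $f'(0)=1$, the radius of starlikeness is \[ r^{\star}(f)=\sup\left\{r>0:\ \Re\left(\frac{zf'(z)}{f(z)}\right)>0\ \text{for all } z\in\mathbb{D}_r\right\},\qquad \mathbb{D}_r=\{z\in\mathbb{C}:|z|<r\}, \] where $zf'(z)/f(z)$ is given its limiting value $1$ at $z=0$ (and the condition requires the quotient to be finite on $\mathbb{D}_r$). The numbers $\sigma_m^{(k)}$ ($k\ge1$, $m\ge0$) are defined by \[ \sigma_m^{(1)}=\frac{(-1)^m}{4},\qquad \sigma_m^{(k)}=\sum_{i=0}^m\sum_{j=0}^i\sum_{n=1}^{k-1}(-k)^{m-i}\sigma_j^{(n)}\sigma_{i-j}^{(k-n)}\quad(k\ge2). \] The ordinary potential polynomials $\mathsf{A}_{\mu,n}$ ($\mu\in\mathbb{C}$, $n\ge0$) are defined by the generating function (formal power series in $z$) \[ \left(1+\sum_{n=1}^\infty x_nz^n\right)^\mu=\sum_{n=0}^\infty\mathsf{A}_{\mu,n}(x_1,x_2,\ldots,x_n)z^n . \] Empty sums are zero. The $\pi_k$ are just names for coefficients (unrelated to the constant $\pi$). The asymptotic expansion is in the Poincaré sense: for every $N\ge1$, $\frac{r^\star(\varphi_\nu)}{\sqrt{2\nu}}=1+\sum_{k=1}^{N-1}\pi_k\nu^{-k}+\mathcal{O}_N(\nu^{-N})$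 as $\nu\to+\infty$. *)

theory Defs
  imports
    "HOL-Analysis.Analysis"
    "HOL-Computational_Algebra.Formal_Power_Series"
    "HOL-Library.Landau_Symbols"
begin

(* The Bessel function of the first kind; powr is the principal branch, so the
   values at z = 0 are not meaningful. *)
definition bessel_J :: "complex \<Rightarrow> complex \<Rightarrow> complex" where
  "bessel_J \<nu> z =
     (z / 2) powr \<nu> *
       (\<Sum>j. (-1) ^ j / fact j * rGamma (\<nu> + 1 + of_nat j) * (z / 2) ^ (2 * j))"

(* The entire function 2^nu Gamma(nu+1) z^(1-nu) J_nu(z); the agreement with this
   expression is lemma phi_eq_bessel_J below. *)
definition phi :: "real \<Rightarrow> complex \<Rightarrow> complex" where
  "phi \<nu> z =
     z * (\<Sum>j. (-1) ^ j * (z\<^sup>2 / 4) ^ j / (fact j * pochhammer (of_real (\<nu> + 1)) j))"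

lemma summable_phi:
  fixes \<nu> :: real and z :: complex
  assumes "\<nu> > -1"
  shows "summable (\<lambda>j. (-1) ^ j * (z\<^sup>2 / 4) ^ j / (fact j * pochhammer (of_real (\<nu> + 1)) j) :: complex)"
proof -
  define a where
    "a j = (-1) ^ j * (z\<^sup>2 / 4) ^ j / (fact j * pochhammer (of_real (\<nu> + 1)) j)" for j
  obtain n0 :: nat where n0: "2 * norm (z\<^sup>2 / 4) \<le> real n0 * (\<nu> + 1)"
  proof -
    obtain n :: nat where "2 * norm (z\<^sup>2 / 4) / (\<nu> + 1) \<le> real n"
      using real_arch_simple by blast
    then show ?thesis using assms that[of n] by (simp add: field_simps)
  qed
  have "norm (a (Suc j)) \<le> 1 / 2 * norm (a j)" if "j \<ge> n0" for j
  proof -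
    define w where "w = (of_real (\<nu> + 1) + of_nat j :: complex)"
    have w: "w = of_real (\<nu> + 1 + real j)" by (simp add: w_def)
    have nw: "norm w = \<nu> + 1 + real j"
      unfolding w norm_of_real using assms by simp
    have "a (Suc j) = a j * (- (z\<^sup>2 / 4) / (of_nat (Suc j) * w))"
      by (simp add: a_def pochhammer_Suc w_def mult_ac)
    then have eq: "norm (a (Suc j)) =
        norm (a j) * (norm (z\<^sup>2 / 4) / (real (Suc j) * (\<nu> + 1 + real j)))"
      by (simp only: norm_mult norm_divide norm_minus_cancel nw norm_of_nat)
    have "2 * norm (z\<^sup>2 / 4) \<le> real (Suc j) * (\<nu> + 1 + real j)"
    proof -
      have "real n0 * (\<nu> + 1) \<le> real (Suc j) * (\<nu> + 1 + real j)"
        using that assms by (intro mult_mono) auto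
      with n0 show ?thesis by linarith
    qed
    moreover have "real (Suc j) * (\<nu> + 1 + real j) > 0"
      using assms by (intro mult_pos_pos) auto
    ultimately have "norm (z\<^sup>2 / 4) / (real (Suc j) * (\<nu> + 1 + real j)) \<le> 1 / 2"
      by (simp only: pos_divide_le_eq)
    then have "norm (a j) * (norm (z\<^sup>2 / 4) / (real (Suc j) * (\<nu> + 1 + real j)))
        \<le> norm (a j) * (1 / 2)"
      by (rule mult_left_mono) simp
    with eq show ?thesis by simp
  qed
  then have "summable a"
    by (intro summable_ratio_test[of "1 / 2" n0]) auto
  then show ?thesis by (simp add: a_def[abs_def])
qed

lemma phi_eq_bessel_J:
  fixes \<nu> :: real and z :: complex
  assumes "\<nu> > -1" and "z \<noteq> 0"
  shows "phi \<nu> z =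
    2 powr of_real \<nu> * Gamma (of_real (\<nu> + 1)) * z powr (1 - of_real \<nu>) * bessel_J (of_real \<nu>) z"
proof -
  define g :: complex where "g = Gamma (of_real (\<nu> + 1))"
  define a where
    "a j = (-1) ^ j * (z\<^sup>2 / 4) ^ j / (fact j * pochhammer (of_real (\<nu> + 1)) j)" for j
  have np: "(of_real (\<nu> + 1) :: complex) \<notin> \<int>\<^sub>\<le>\<^sub>0"
  proof
    assume "(of_real (\<nu> + 1) :: complex) \<in> \<int>\<^sub>\<le>\<^sub>0"
    then have "\<nu> + 1 \<in> \<int>\<^sub>\<le>\<^sub>0" by (simp only: of_real_in_nonpos_Ints_iff)
    then show False using assms(1) nonpos_Ints_nonpos by fastforce
  qed
  then have g0: "g \<noteq> 0" by (simp add: g_def Gamma_eq_zero_iff)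
  have coeff: "(-1) ^ j / fact j * rGamma (of_real \<nu> + 1 + of_nat j) * (z / 2) ^ (2 * j)
      = a j / g" for j
  proof -
    have "rGamma (of_real \<nu> + 1 + of_nat j :: complex)
        = 1 / (pochhammer (of_real (\<nu> + 1)) j * g)"
      using pochhammer_Gamma[OF np, of j] g0
      by (simp add: g_def rGamma_inverse_Gamma field_simps)
    moreover have "(z / 2) ^ (2 * j) = (z\<^sup>2 / 4) ^ j"
      by (simp add: power_mult power_divide)
    ultimately show ?thesis by (simp add: a_def mult_ac)
  qed
  have sum: "(\<Sum>j. a j / g) = (\<Sum>j. a j) / g"
    using summable_phi[OF assms(1), of z]
    by (intro suminf_divide) (simp add: a_def[abs_def])
  have pow: "2 powr of_real \<nu> * z powr (1 - of_real \<nu>) * (z / 2) powr of_real \<nu> = z"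
  proof -
    have "Ln (z / 2) = Ln z - of_real (ln 2)"
      using assms(2) Ln_divide_of_real[of 2 z] by simp
    moreover have "Ln (2 :: complex) = of_real (ln 2)"
      using Ln_of_real[of 2] by simp
    moreover have "exp (of_real \<nu> * of_real (ln 2)) * exp ((1 - of_real \<nu>) * Ln z) *
        exp (of_real \<nu> * (Ln z - of_real (ln 2))) = exp (Ln z)"
      by (simp add: algebra_simps flip: exp_add)
    ultimately show ?thesis
      using assms(2) by (simp add: powr_def)
  qed
  have "2 powr of_real \<nu> * g * z powr (1 - of_real \<nu>) * bessel_J (of_real \<nu>) z =
      (2 powr of_real \<nu> * z powr (1 - of_real \<nu>) * (z / 2) powr of_real \<nu>) * (g * ((\<Sum>j. a j) / g))"
    unfolding bessel_J_def coeff sum by (simp only: mult_ac)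
  also have "\<dots> = z * (\<Sum>j. a j)"
    using g0 by (simp add: pow)
  also have "\<dots> = phi \<nu> z" by (simp add: phi_def a_def)
  finally show ?thesis by (simp add: g_def)
qed

(* z f'(z) / f(z) with its limiting value at the origin, for f(0) = 0 and f'(0) = 1. *)
definition starlike_quotient :: "(complex \<Rightarrow> complex) \<Rightarrow> complex \<Rightarrow> complex" where
  "starlike_quotient f z = (if z = 0 then 1 else z * deriv f z / f z)"

(* The supremum is that of the reals, hence meaningful only where the set is
   nonempty and bounded, as is the case for phi \<nu> with \<nu> > -1.  The condition
   f z \<noteq> 0 expresses finiteness of the quotient. *)
definition starlike_radius :: "(complex \<Rightarrow> complex) \<Rightarrow> real" where
  "starlike_radius f =
     Sup {r. r > 0 \<and>
             (\<forall>z\<in>ball 0 r. (z \<noteq> 0 \<longrightarrow> f z \<noteq> 0) \<and> Re (starlike_quotient f z) > 0)}"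

(* sigma k m is the number with upper index k and lower index m, for k \<ge> 1. *)
fun sigma :: "nat \<Rightarrow> nat \<Rightarrow> real" where
  "sigma k m =
     (if k = 1 then (-1) ^ m / 4
      else \<Sum>i=0..m. \<Sum>j=0..i. \<Sum>n=1..<k.
             (- real k) ^ (m - i) * sigma n j * sigma (k - n) (i - j))"

declare sigma.simps [simp del]

(* Coefficient of z^n in (1 + x 1 * z + x 2 * z^2 + ...)^\<mu>, the power being the
   binomial series; x 0 is not used. *)
definition potential_poly :: "'a::field_char_0 \<Rightarrow> nat \<Rightarrow> (nat \<Rightarrow> 'a) \<Rightarrow> 'a" where
  "potential_poly \<mu> n x =
     fps_nth (fps_binomial \<mu> oo Abs_fps (\<lambda>i. if i = 0 then 0 else x i)) n"

lemma potential_poly_of_nat: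
  "potential_poly (of_nat k) n x =
     fps_nth ((1 + Abs_fps (\<lambda>i. if i = 0 then 0 else x i)) ^ k) n"
proof -
  have "(1 + fps_X) ^ k oo b = (1 + b) ^ k" if "fps_nth b 0 = 0" for b :: "'a fps"
    using that by (simp add: fps_compose_power [symmetric] fps_compose_add_distrib)
  then show ?thesis by (simp add: potential_poly_def fps_binomial_of_nat)
qed

lemma fps_power_nth_cong:
  fixes a b :: "'a::comm_semiring_1 fps"
  assumes "\<And>i. i \<le> n \<Longrightarrow> fps_nth a i = fps_nth b i" and "m \<le> n"
  shows "fps_nth (a ^ k) m = fps_nth (b ^ k) m"
  using assms(2)
proof (induction k arbitrary: m)
  case (Suc k)
  then show ?case
    by (auto simp: fps_mult_nth intro!: sum.cong arg_cong2[where f = "(*)"] assms(1))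
qed simp

(* Only x 1, ..., x n matter; this also justifies the termination of rho below. *)
lemma potential_poly_cong [fundef_cong]:
  assumes "\<mu> = \<mu>'" "n = n'" "\<And>i. 1 \<le> i \<Longrightarrow> i \<le> n' \<Longrightarrow> x i = x' i"
  shows "potential_poly \<mu> n x = potential_poly \<mu>' n' x'"
  unfolding potential_poly_def fps_compose_nth assms(1,2)
  by (intro sum.cong arg_cong2[where f = "(*)"] fps_power_nth_cong[where n = n'])
     (auto intro: assms(3))

(* Relevant for k \<ge> 1 only.  Since subtraction of naturals truncates, k - n + 1 is
   written as k + 1 - n. *)
fun rho :: "nat \<Rightarrow> real" where
  "rho k =
     (-1) ^ (k + 1)
     - (\<Sum>n=1..<k. (-1) ^ (k - n) * rho n)
     - (\<Sum>n=2..k + 1. 2 ^ (n + 1) *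
          (\<Sum>m=0..k + 1 - n. sigma n (k + 1 - n - m) * potential_poly (real n) m (\<lambda>i. rho i)))"

declare rho.simps [simp del]

(* Relevant for k \<ge> 1 only. *)
fun pi_coeff :: "nat \<Rightarrow> real" where
  "pi_coeff k = rho k / 2 - (\<Sum>n=1..<k. pi_coeff n * pi_coeff (k - n)) / 2"

declare pi_coeff.simps [simp del]

end

theory Submission
  imports Defs
begin

text \<open>
Write \<open>\<phi>(z) = z F(z\<^sup>2)\<close> and \<open>z \<phi>'(z) / \<phi>(z) = 1 - H(z\<^sup>2)\<close>. Bessel's equation for \<open>F\<close> turns into the
Riccati equation \<open>2 x H' + 2 \<nu> H = x + H\<^sup>2\<close>, which determines the Taylor coefficients of \<open>H\<close>
recursively and shows that they are nonnegative (\<open>phi_fps_log_deriv\<close>). This settles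
the geometry: \<open>|H(z\<^sup>2)| \<le> H(|z|\<^sup>2)\<close>, so the radius of starlikeness is the number \<open>R\<close> with
\<open>H(R\<^sup>2) = 1\<close> (\<open>starlike_radius_phi_eqI\<close>). A bound for the coefficients shows that \<open>H\<close> converges on
the disc \<open>|x| < \<nu>\<^sup>2\<close>, where \<open>F\<close>, being an exponential, has no zero; for \<open>\<nu> \<ge> 3\<close> this disc
contains \<open>R\<^sup>2\<close>.

For the asymptotics put \<open>e = 1 / \<nu>\<close> and \<open>R\<^sup>2 = 2 \<nu> t\<close>. The equation for \<open>R\<close> becomes
\<open>(\<Sum>n\<ge>1. 2^(n+1) e^(n-1) s_n(e) t^n) = 1\<close>,
where \<open>s_1 = 1 / (4 (1 + e))\<close> and \<open>(1 + k e) s_k\<close> is the sum of \<open>s_n s_(k-n)\<close> over \<open>0 < n < k\<close>.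
The numbers \<open>sigma k m\<close> are the coefficients of \<open>s_k\<close> in powers of \<open>e\<close>, and the recurrence for
\<open>rho\<close> is the statement that \<open>t = 1 + \<Sum> rho k e^k\<close> solves the equation formally
(\<open>radius_equation_fps_nth\<close>). The formal solution is asymptotic to the true one because the
left side has slope at least \<open>1 / 2\<close> in \<open>t\<close> and because \<open>\<Sum> s_k \<le> 1 / 2\<close> uniformly in \<open>e\<close>, so
that cutting the sum after \<open>n = N\<close> costs only \<open>O(e^N)\<close>
(\<open>asymp_expansion_radius_square\<close>). The denominator \<open>1 + k e\<close> of \<open>s_k\<close> vanishes at
\<open>e = - 1 / k\<close>, so no neighbourhood of 0 suits all \<open>k\<close>; the argument therefore works with truncated
expansions in \<open>e > 0\<close> and never with convergent series in \<open>e\<close>. Finally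
\<open>R / sqrt (2 \<nu>) = sqrt t\<close>, and the recurrence for \<open>pi_coeff\<close> extracts the square root of the formal
series.
\<close>

section \<open>Rescaled Rayleigh coefficients\<close>

text \<open>
With \<open>e = 1 / \<nu>\<close>, these are the Taylor coefficients of \<open>z J_(\<nu>+1)(z) / J_\<nu>(z)\<close> at the
origin, rescaled: the coefficient of \<open>z^(2k)\<close> is \<open>2 \<nu> rayleigh_coeff e k / \<nu>^(2k)\<close>.
In this normalisation they satisfy a recurrence with a finite limit as \<open>e \<rightarrow> 0\<close>, namely
that of the Catalan numbers \<open>C_(k-1)\<close> divided by \<open>4^k\<close>; expanding it in powers of \<open>e\<close> is what
defines the numbers \<open>sigma k m\<close>.
\<close>

fun rayleigh_coeff :: "real \<Rightarrow> nat \<Rightarrow> real" where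
  "rayleigh_coeff e k =
     ((if k = 1 then 1 / 4 else 0)
       + (\<Sum>n=1..<k. rayleigh_coeff e n * rayleigh_coeff e (k - n))) / (1 + real k * e)"

declare rayleigh_coeff.simps [simp del]

lemma rayleigh_coeff_0 [simp]: "rayleigh_coeff e 0 = 0"
  by (subst rayleigh_coeff.simps) simp

lemma rayleigh_coeff_1: "rayleigh_coeff e (Suc 0) = 1 / (4 * (1 + e))"
  by (subst rayleigh_coeff.simps) simp

text \<open>
The index 0, where the coefficient is 0, is included in the convolution so that it becomes
a coefficient of the square of a power series.
\<close>

lemma rayleigh_coeff_recurrence:
  assumes "e \<ge> 0"
  shows "(1 + real k * e) * rayleigh_coeff e k =
    (if k = 1 then 1 / 4 else 0) + (\<Sum>n\<le>k. rayleigh_coeff e n * rayleigh_coeff e (k - n))"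
proof -
  have "1 + real k * e > 0"
    using assms by (intro add_pos_nonneg) auto
  moreover have "(\<Sum>n=1..<k. rayleigh_coeff e n * rayleigh_coeff e (k - n)) =
      (\<Sum>n\<le>k. rayleigh_coeff e n * rayleigh_coeff e (k - n))"
    by (rule sum.mono_neutral_left) (auto simp: not_le not_less)
  ultimately show ?thesis
    using rayleigh_coeff.simps[of e k] by (simp add: field_simps)
qed

lemma rayleigh_coeff_nonneg:
  assumes "e \<ge> 0"
  shows "rayleigh_coeff e k \<ge> 0"
proof (induction k rule: less_induct)
  case (less k)
  then show ?case
    using assms by (subst rayleigh_coeff.simps)
      (auto intro!: divide_nonneg_nonneg add_nonneg_nonneg sum_nonneg mult_nonneg_nonneg)
qed

text \<open>
If \<open>S\<close> is a partial sum, dropping the factor \<open>1 + k e \<ge> 1\<close> from the recurrence bounds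
the next partial sum by \<open>1 / 4 + S\<^sup>2\<close>, and this map sends \<open>[0, 1 / 2]\<close> to itself. The bound,
uniform in \<open>e\<close>, gives both the convergence of the Taylor series on a disc of radius \<open>\<nu>\<close> and
the control of its tails as \<open>\<nu> \<rightarrow> \<infinity>\<close>.
\<close>

lemma sum_rayleigh_coeff_le:
  assumes "e \<ge> 0"
  shows "(\<Sum>k<K. rayleigh_coeff e k) \<le> 1 / 2"
proof (induction K)
  case (Suc K)
  let ?s = "rayleigh_coeff e"
  let ?T = "{(i, j). i + j < Suc K}" and ?Q = "{..<K} \<times> {..<K}"
  note nonneg = rayleigh_coeff_nonneg[OF assms]
  have finite_T: "finite ?T"
    by (rule finite_subset[of _ "{..K} \<times> {..K}"]) auto
  have "?s k \<le> (if k = 1 then 1 / 4 else 0) + (\<Sum>n\<le>k. ?s n * ?s (k - n))" for k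
  proof -
    have "1 * ?s k \<le> (1 + real k * e) * ?s k"
      using assms nonneg by (intro mult_right_mono) auto
    then show ?thesis
      using rayleigh_coeff_recurrence[OF assms, of k] by (simp only: mult_1)
  qed
  then have "(\<Sum>k<Suc K. ?s k) \<le>
      (\<Sum>k<Suc K. (if k = 1 then 1 / 4 else 0) + (\<Sum>n\<le>k. ?s n * ?s (k - n)))"
    by (rule sum_mono)
  also have "\<dots> \<le> 1 / 4 + (\<Sum>k<Suc K. \<Sum>n\<le>k. ?s n * ?s (k - n))"
    unfolding sum.distrib by (intro add_right_mono) (simp add: sum.delta del: sum.lessThan_Suc)
  also have "(\<Sum>k<Suc K. \<Sum>n\<le>k. ?s n * ?s (k - n)) = (\<Sum>(i,j)\<in>?T. ?s i * ?s j)"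
    by (rule sum.triangle_reindex[symmetric])
  \<comment> \<open>A pair outside the square contains the index 0, where the coefficient vanishes.\<close>
  also have "\<dots> = (\<Sum>(i,j)\<in>?T \<inter> ?Q. ?s i * ?s j)"
  proof (rule sum.mono_neutral_right[OF finite_T])
    show "\<forall>p\<in>?T - ?T \<inter> ?Q. (case p of (i, j) \<Rightarrow> ?s i * ?s j) = 0"
    proof clarify
      fix i j assume "i + j < Suc K" "(i, j) \<notin> ?T \<inter> ?Q"
      then have "i = 0 \<or> j = 0" by auto
      then show "?s i * ?s j = 0" by auto
    qed
  qed auto
  also have "\<dots> \<le> (\<Sum>(i,j)\<in>?Q. ?s i * ?s j)"
    by (rule sum_mono2) (auto intro!: mult_nonneg_nonneg nonneg)
  also have "\<dots> = (\<Sum>k<K. ?s k)\<^sup>2"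
    by (simp add: power2_eq_square sum_product sum.cartesian_product)
  also have "\<dots> \<le> (1 / 2)\<^sup>2"
    using Suc by (intro power_mono sum_nonneg nonneg) auto
  finally show ?case by (simp add: power2_eq_square)
qed simp

lemma summable_rayleigh_coeff:
  assumes "e \<ge> 0"
  shows "summable (rayleigh_coeff e)"
  using sum_rayleigh_coeff_le[OF assms] rayleigh_coeff_nonneg[OF assms]
  by (intro summableI_nonneg_bounded[of _ "1 / 2"]) auto

lemma suminf_rayleigh_coeff_le:
  assumes "e \<ge> 0"
  shows "(\<Sum>k. rayleigh_coeff e k) \<le> 1 / 2"
  using sum_rayleigh_coeff_le[OF assms] summable_rayleigh_coeff[OF assms]
  by (intro suminf_le_const) auto

lemma rayleigh_coeff_le:
  assumes "e \<ge> 0"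
  shows "rayleigh_coeff e k \<le> 1 / 2"
  using sum_rayleigh_coeff_le[OF assms, of "Suc k"]
    sum_nonneg[of "{..<k}" "rayleigh_coeff e"] rayleigh_coeff_nonneg[OF assms] by simp

section \<open>The Riccati equation for the logarithmic derivative\<close>

text \<open>
The function \<open>z J_(\<nu>+1)(z) / J_\<nu>(z) = 1 - z \<phi>'(z) / \<phi>(z)\<close> as a power series in \<open>z\<^sup>2\<close>. It is
needed both over the complex numbers, for the starlikeness condition, and over the reals,
for locating the radius.
\<close>

definition bessel_ratio_fps :: "real \<Rightarrow> 'a::{real_normed_field, banach} fps" where
  "bessel_ratio_fps \<nu> = Abs_fps (\<lambda>k. of_real (2 * \<nu> * rayleigh_coeff (1 / \<nu>) k / \<nu> ^ (2 * k)))"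

text \<open>
The series \<open>F\<close> with \<open>\<phi>(z) = z F(z\<^sup>2)\<close>.
\<close>

definition phi_fps :: "real \<Rightarrow> complex fps" where
  "phi_fps \<nu> = Abs_fps (\<lambda>j. (- 1 / 4) ^ j / (fact j * pochhammer (of_real (\<nu> + 1)) j))"

lemma bessel_ratio_fps_nth_0 [simp]: "fps_nth (bessel_ratio_fps \<nu>) 0 = 0"
  by (simp add: bessel_ratio_fps_def)

text \<open>
Written with coefficients, this is the Riccati equation \<open>2 X H' + 2 \<nu> H = X + H\<^sup>2\<close>.
\<close>

lemma bessel_ratio_fps_riccati:
  assumes "\<nu> > 0"
  shows "of_nat (2 * k) * fps_nth (bessel_ratio_fps \<nu>) k
      + of_real (2 * \<nu>) * fps_nth (bessel_ratio_fps \<nu>) k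
    = fps_nth (fps_X + (bessel_ratio_fps \<nu> :: 'a::{real_normed_field, banach} fps)\<^sup>2) k"
proof -
  let ?s = "rayleigh_coeff (1 / \<nu>)"
  define r where "r k = 2 * \<nu> * ?s k / \<nu> ^ (2 * k)" for k
  have "real (2 * k) * r k + 2 * \<nu> * r k = 4 * \<nu>\<^sup>2 / \<nu> ^ (2 * k) * ((1 + real k * (1 / \<nu>)) * ?s k)"
    using assms by (simp add: r_def field_simps power2_eq_square)
  also have "\<dots> = (if k = 1 then 1 else 0) + 4 * \<nu>\<^sup>2 / \<nu> ^ (2 * k) * (\<Sum>n\<le>k. ?s n * ?s (k - n))"
    using assms by (subst rayleigh_coeff_recurrence) (auto simp: field_simps power2_eq_square)
  also have "4 * \<nu>\<^sup>2 / \<nu> ^ (2 * k) * (\<Sum>n\<le>k. ?s n * ?s (k - n)) = (\<Sum>n\<le>k. r n * r (k - n))"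
    unfolding sum_distrib_left
  proof (rule sum.cong)
    fix n assume "n \<in> {..k}"
    then have "\<nu> ^ (2 * k) = \<nu> ^ (2 * n) * \<nu> ^ (2 * (k - n))"
      by (simp flip: power_add add: algebra_simps)
    then show "4 * \<nu>\<^sup>2 / \<nu> ^ (2 * k) * (?s n * ?s (k - n)) = r n * r (k - n)"
      by (simp add: r_def power2_eq_square)
  qed simp
  finally have "of_real (real (2 * k) * r k + 2 * \<nu> * r k) =
      (of_real ((if k = 1 then 1 else 0) + (\<Sum>n\<le>k. r n * r (k - n))) :: 'a)"
    by simp
  moreover have nth: "fps_nth (bessel_ratio_fps \<nu> :: 'a fps) k = of_real (r k)" for k
    by (simp add: bessel_ratio_fps_def r_def)
  ultimately show ?thesis
    by (cases "k = 1") (simp_all add: nth power2_eq_square fps_mult_nth atLeast0AtMost)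
qed

lemma phi_fps_nth_0 [simp]: "fps_nth (phi_fps \<nu>) 0 = 1"
  by (simp add: phi_fps_def)

text \<open>
Bessel's differential equation in the variable \<open>X = z\<^sup>2\<close>.
\<close>

lemma phi_fps_bessel_equation:
  assumes "\<nu> > 0"
  shows "4 * fps_X * fps_deriv (fps_deriv (phi_fps \<nu>))
      + fps_const (of_real (4 * (\<nu> + 1))) * fps_deriv (phi_fps \<nu>) + phi_fps \<nu> = 0"
proof (rule fps_ext)
  fix j
  have nz: "of_real \<nu> + 1 + of_nat j \<noteq> (0 :: complex)"
  proof -
    have "of_real \<nu> + 1 + of_nat j = (of_real (\<nu> + 1 + real j) :: complex)" by simp
    also have "\<dots> \<noteq> 0" using assms by (simp only: of_real_eq_0_iff)
    finally show ?thesis .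
  qed
  have "fps_nth (phi_fps \<nu>) (Suc j) =
      fps_nth (phi_fps \<nu>) j * (- 1 / 4) / (of_nat (Suc j) * (of_real \<nu> + 1 + of_nat j))"
    by (simp add: phi_fps_def pochhammer_Suc mult_ac)
  moreover have "m * a' * (4 * w) = - a" if "a' = a * (- 1 / 4) / (m * w)" "m \<noteq> 0" "w \<noteq> 0"
    for a a' m w :: complex
    using that by simp
  ultimately have step: "of_nat (Suc j) * fps_nth (phi_fps \<nu>) (Suc j) * (4 * (of_real \<nu> + 1 + of_nat j))
      = - fps_nth (phi_fps \<nu>) j"
    using nz of_nat_neq_0 by blast
  have "fps_nth (4 * (fps_X * fps_deriv (fps_deriv (phi_fps \<nu>)))) j =
    4 * of_nat j * (of_nat (Suc j) * fps_nth (phi_fps \<nu>) (Suc j))"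
    by (cases j) (simp_all add: fps_numeral_simps numeral_fps_const)
  with step show "fps_nth (4 * fps_X * fps_deriv (fps_deriv (phi_fps \<nu>))
      + fps_const (of_real (4 * (\<nu> + 1))) * fps_deriv (phi_fps \<nu>) + phi_fps \<nu>) j = fps_nth 0 j"
    by (simp add: mult.assoc) (simp add: algebra_simps)
qed

text \<open>
The coefficients of a solution without constant term are determined one after another,
because the \<open>k\<close>-th coefficient of its square involves only earlier ones and the factor
\<open>2 k + 2 \<nu>\<close> on the left is not zero.
\<close>

lemma fps_riccati_unique:
  fixes A B :: "complex fps"
  assumes "\<nu> > 0" "fps_nth A 0 = 0" "fps_nth B 0 = 0"
    and "\<And>k. of_nat (2 * k) * fps_nth A k + of_real (2 * \<nu>) * fps_nth A k
           = fps_nth (fps_X + A\<^sup>2) k"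
    and "\<And>k. of_nat (2 * k) * fps_nth B k + of_real (2 * \<nu>) * fps_nth B k
           = fps_nth (fps_X + B\<^sup>2) k"
  shows "A = B"
proof (rule fps_ext)
  fix k
  show "fps_nth A k = fps_nth B k"
  proof (induction k rule: less_induct)
    case (less k)
    have "fps_nth A i * fps_nth A (k - i) = fps_nth B i * fps_nth B (k - i)" if "i \<le> k" for i
    proof (cases "i = 0 \<or> i = k")
      case False
      with that show ?thesis using less[of i] less[of "k - i"] by simp
    qed (use assms(2,3) in auto)
    then have "fps_nth (A\<^sup>2) k = fps_nth (B\<^sup>2) k"
      unfolding power2_eq_square fps_mult_nth by (intro sum.cong) auto
    then have "(of_nat (2 * k) + of_real (2 * \<nu>)) * fps_nth A k =
        (of_nat (2 * k) + of_real (2 * \<nu>)) * fps_nth B k"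
      using assms(4)[of k] assms(5)[of k] by (simp add: distrib_right)
    moreover have "(of_nat (2 * k) + of_real (2 * \<nu>) :: complex) = of_real (real (2 * k) + 2 * \<nu>)"
      by simp
    then have "(of_nat (2 * k) + of_real (2 * \<nu>) :: complex) \<noteq> 0"
      using assms(1) by (simp only: of_real_eq_0_iff)
    ultimately show ?case by simp
  qed
qed

text \<open>
The logarithmic derivative of a solution of a linear equation of second order solves a
Riccati equation. So \<open>- 2 X F' / F\<close> solves the equation that the rescaled Rayleigh
coefficients were made for, and uniqueness identifies the two series.
\<close>

lemma phi_fps_log_deriv:
  assumes "\<nu> > 0"
  shows "phi_fps \<nu> * bessel_ratio_fps \<nu> = - 2 * fps_X * fps_deriv (phi_fps \<nu>)"
proof -
  define F where "F = phi_fps \<nu>"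
  define c :: "complex fps" where "c = fps_const (of_real \<nu>)"
  define H where "H = - 2 * fps_X * fps_deriv F * inverse F"
  have F0: "fps_nth F 0 = 1" by (simp add: F_def)
  then have inv: "F * inverse F = 1" by (simp add: inverse_mult_eq_1')
  have FH: "F * H = - 2 * fps_X * fps_deriv F"
    using inv unfolding H_def by (metis (no_types, lifting) mult.left_commute mult.right_neutral)
  have ode: "4 * fps_X * fps_deriv (fps_deriv F) + 4 * (c + 1) * fps_deriv F + F = 0"
  proof -
    have "fps_const (of_real (4 * (\<nu> + 1))) = 4 * (c + 1)"
      by (simp add: c_def numeral_fps_const flip: fps_const_add fps_const_mult fps_const_1_eq_1)
    then show ?thesis using phi_fps_bessel_equation[OF assms] by (simp add: F_def)
  qed
  have deriv: "fps_deriv F * H + F * fps_deriv H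
      = - 2 * fps_deriv F - 2 * fps_X * fps_deriv (fps_deriv F)"
    using arg_cong[OF FH, of fps_deriv] by (simp add: algebra_simps)
  \<comment> \<open>Multiply the derivative by \<open>2 X\<close>; then the equation eliminates \<open>F''\<close>, and \<open>F H = - 2 X F'\<close> eliminates \<open>F'\<close>.\<close>
  have "F * (2 * fps_X * fps_deriv H + 2 * c * H) = F * (fps_X + H\<^sup>2)"
    using FH ode deriv by algebra
  moreover have "F \<noteq> 0" using F0 by auto
  ultimately have riccati: "2 * fps_X * fps_deriv H + 2 * c * H = fps_X + H\<^sup>2"
    by simp
  have "H = bessel_ratio_fps \<nu>"
  proof (rule fps_riccati_unique[OF assms])
    show "fps_nth H 0 = 0" by (simp add: H_def mult.assoc numeral_fps_const)
    fix k
    have "fps_nth (2 * (fps_X * fps_deriv H)) k = of_nat (2 * k) * fps_nth H k"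
      by (cases k) (simp_all add: numeral_fps_const)
    moreover have "fps_nth (2 * (c * H)) k = of_real (2 * \<nu>) * fps_nth H k"
      by (simp add: c_def numeral_fps_const)
    ultimately show "of_nat (2 * k) * fps_nth H k + of_real (2 * \<nu>) * fps_nth H k
        = fps_nth (fps_X + H\<^sup>2) k"
      using arg_cong[OF riccati, of "\<lambda>f. fps_nth f k"] by (simp only: fps_add_nth mult.assoc)
  qed (use bessel_ratio_fps_riccati[OF assms, where 'a = complex] in \<open>simp_all only: bessel_ratio_fps_nth_0\<close>)
  with FH show ?thesis by (simp add: F_def)
qed

section \<open>The radius of starlikeness as a root\<close>

lemma bessel_ratio_fps_nth:
  "fps_nth (bessel_ratio_fps \<nu>) k = of_real (fps_nth (bessel_ratio_fps \<nu>) k)"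
  by (simp add: bessel_ratio_fps_def)

lemma bessel_ratio_fps_nth_nonneg:
  assumes "\<nu> > 0"
  shows "fps_nth (bessel_ratio_fps \<nu> :: real fps) k \<ge> 0"
  using assms rayleigh_coeff_nonneg[of "1 / \<nu>" k] by (simp add: bessel_ratio_fps_def)

lemma bessel_ratio_fps_nth_le:
  assumes "\<nu> > 0"
  shows "fps_nth (bessel_ratio_fps \<nu> :: real fps) k \<le> \<nu> / (\<nu>\<^sup>2) ^ k"
proof -
  have "2 * \<nu> * rayleigh_coeff (1 / \<nu>) k \<le> \<nu>"
    using assms rayleigh_coeff_le[of "1 / \<nu>" k] by simp
  then have "2 * \<nu> * rayleigh_coeff (1 / \<nu>) k / (\<nu>\<^sup>2) ^ k \<le> \<nu> / (\<nu>\<^sup>2) ^ k"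
    using assms by (intro divide_right_mono) auto
  then show ?thesis by (simp add: bessel_ratio_fps_def power_mult)
qed

text \<open>
Stated for a dominated series so that it also applies to a primitive of the series divided
by \<open>X\<close>, which occurs in the proof that \<open>F\<close> has no zeros.
\<close>

lemma fps_conv_radius_ge_bessel_ratio:
  fixes f :: "'a::{banach, real_normed_field} fps"
  assumes "\<nu> > 0" "\<And>k. norm (fps_nth f k) \<le> fps_nth (bessel_ratio_fps \<nu>) k"
  shows "fps_conv_radius f \<ge> ereal (\<nu>\<^sup>2)"
  unfolding fps_conv_radius_def
proof (rule conv_radius_geI_ex')
  fix r assume r: "0 < r" "ereal r < ereal (\<nu>\<^sup>2)"
  show "summable (\<lambda>k. fps_nth f k * of_real r ^ k)"
  proof (rule summable_comparison_test')
    show "summable (\<lambda>k. \<nu> * (r / \<nu>\<^sup>2) ^ k)"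
      using r assms(1) by (intro summable_mult summable_geometric) auto
    fix k
    have "norm (fps_nth f k * of_real r ^ k) \<le> \<nu> / (\<nu>\<^sup>2) ^ k * r ^ k"
      using r order_trans[OF assms(2) bessel_ratio_fps_nth_le[OF assms(1)], of k]
      by (simp only: norm_mult norm_power norm_of_real, intro mult_mono)
         (use assms(1) in auto)
    then show "norm (fps_nth f k * of_real r ^ k) \<le> \<nu> * (r / \<nu>\<^sup>2) ^ k"
      by (simp add: power_divide)
  qed
qed

lemma fps_conv_radius_bessel_ratio:
  assumes "\<nu> > 0"
  shows "fps_conv_radius (bessel_ratio_fps \<nu> :: 'a::{banach, real_normed_field} fps) \<ge> ereal (\<nu>\<^sup>2)"
proof (rule fps_conv_radius_ge_bessel_ratio[OF assms])
  fix k
  have "norm (of_real (fps_nth (bessel_ratio_fps \<nu>) k) :: 'a) \<le> fps_nth (bessel_ratio_fps \<nu>) k"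
    unfolding norm_of_real using bessel_ratio_fps_nth_nonneg[OF assms, of k] by simp
  then show "norm (fps_nth (bessel_ratio_fps \<nu> :: 'a fps) k) \<le> fps_nth (bessel_ratio_fps \<nu>) k"
    by (subst bessel_ratio_fps_nth)
qed

lemma less_fps_conv_radius_bessel_ratio:
  fixes x :: "'a::{banach, real_normed_field}"
  assumes "\<nu> > 0" "norm x < \<nu>\<^sup>2"
  shows "ereal (norm x) < fps_conv_radius (bessel_ratio_fps \<nu> :: 'a fps)"
  using assms(2) by (intro less_le_trans[OF _ fps_conv_radius_bessel_ratio[OF assms(1)]]) simp

lemma summable_bessel_ratio:
  fixes x :: "'a::{banach, real_normed_field}"
  assumes "\<nu> > 0" "norm x < \<nu>\<^sup>2"
  shows "summable (\<lambda>k. fps_nth (bessel_ratio_fps \<nu> :: 'a fps) k * x ^ k)"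
  by (intro summable_fps less_fps_conv_radius_bessel_ratio assms)

lemma eval_bessel_ratio_of_real:
  assumes "\<nu> > 0" "\<bar>x\<bar> < \<nu>\<^sup>2"
  shows "eval_fps (bessel_ratio_fps \<nu>) (of_real x :: complex) = of_real (eval_fps (bessel_ratio_fps \<nu>) x)"
proof -
  have "(\<lambda>k. of_real (fps_nth (bessel_ratio_fps \<nu>) k * x ^ k)) sums
      (of_real (eval_fps (bessel_ratio_fps \<nu>) x) :: complex)"
    using assms by (intro sums_of_real sums_eval_fps less_fps_conv_radius_bessel_ratio) auto
  then show ?thesis
    unfolding eval_fps_def
    by (subst bessel_ratio_fps_nth) (simp add: sums_iff)
qed

text \<open>
All coefficients are nonnegative, so the modulus is largest on the positive axis.
\<close>

lemma norm_eval_bessel_ratio_le: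
  fixes z :: complex
  assumes "\<nu> > 0" "norm z < \<nu>\<^sup>2"
  shows "norm (eval_fps (bessel_ratio_fps \<nu>) z) \<le> eval_fps (bessel_ratio_fps \<nu>) (norm z)"
proof -
  have eq: "norm (fps_nth (bessel_ratio_fps \<nu>) k * z ^ k) = fps_nth (bessel_ratio_fps \<nu>) k * norm z ^ k"
    for k
    using bessel_ratio_fps_nth_nonneg[OF assms(1), of k]
    by (subst bessel_ratio_fps_nth) (simp add: norm_mult norm_power)
  show ?thesis
    unfolding eval_fps_def eq[symmetric]
    using summable_bessel_ratio[OF assms(1), of "norm z"] assms(2)
    by (intro summable_norm) (simp only: eq, simp)
qed

text \<open>
All coefficients are nonnegative, so the linear term alone bounds the increment from below.
\<close>

lemma eval_bessel_ratio_diff_ge: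
  fixes x y :: real
  assumes "\<nu> > 0" "0 \<le> x" "x \<le> y" "y < \<nu>\<^sup>2"
  shows "eval_fps (bessel_ratio_fps \<nu>) y - eval_fps (bessel_ratio_fps \<nu>) x
    \<ge> (y - x) / (2 * (\<nu> + 1))"
proof -
  let ?h = "fps_nth (bessel_ratio_fps \<nu>)"
  have sx: "summable (\<lambda>k. ?h k * x ^ k)" and sy: "summable (\<lambda>k. ?h k * y ^ k)"
    using assms by (auto intro!: summable_bessel_ratio)
  have mono: "?h k * y ^ k - ?h k * x ^ k \<ge> 0" for k
    using assms by (auto intro!: mult_left_mono power_mono bessel_ratio_fps_nth_nonneg)
  have "(y - x) / (2 * (\<nu> + 1)) = (\<Sum>k\<in>{1}. ?h k * y ^ k - ?h k * x ^ k)"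
    using assms(1)
    by (simp add: bessel_ratio_fps_def rayleigh_coeff_1 power2_eq_square divide_simps)
       (simp add: algebra_simps)
  also have "\<dots> \<le> (\<Sum>k. ?h k * y ^ k - ?h k * x ^ k)"
    using mono by (intro sum_le_suminf summable_diff sx sy) auto
  also have "\<dots> = eval_fps (bessel_ratio_fps \<nu>) y - eval_fps (bessel_ratio_fps \<nu>) x"
    unfolding eval_fps_def by (rule suminf_diff[OF sy sx, symmetric])
  finally show ?thesis .
qed

lemma phi_series_term:
  "(-1) ^ j * (z\<^sup>2 / 4) ^ j / (fact j * pochhammer (of_real (\<nu> + 1)) j)
    = fps_nth (phi_fps \<nu>) j * (z\<^sup>2) ^ j"
proof -
  have "(-1) ^ j * (z\<^sup>2 / 4) ^ j = (- 1 / 4) ^ j * (z\<^sup>2) ^ j"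
    by (simp only: power_mult_distrib[symmetric]) simp
  then show ?thesis by (simp add: phi_fps_def)
qed

lemma phi_fps_conv_radius:
  assumes "\<nu> > 0"
  shows "fps_conv_radius (phi_fps \<nu>) = \<infinity>"
  unfolding fps_conv_radius_def
proof (rule conv_radius_inftyI'')
  fix x :: complex
  show "summable (\<lambda>j. fps_nth (phi_fps \<nu>) j * x ^ j)"
    using summable_phi[of \<nu> "csqrt x"] assms unfolding phi_series_term by simp
qed

lemma phi_eq_eval_fps: "phi \<nu> z = z * eval_fps (phi_fps \<nu>) (z\<^sup>2)"
  unfolding phi_def eval_fps_def phi_series_term ..

lemma eval_phi_fps_log_deriv:
  assumes "\<nu> > 0" "norm x < \<nu>\<^sup>2"
  shows "eval_fps (phi_fps \<nu>) x * eval_fps (bessel_ratio_fps \<nu>) x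
    = - 2 * x * eval_fps (fps_deriv (phi_fps \<nu>)) x"
proof -
  have deriv_radius: "fps_conv_radius (fps_deriv (phi_fps \<nu>)) = \<infinity>"
    using fps_conv_radius_deriv[of "phi_fps \<nu>"] phi_fps_conv_radius[OF assms(1)] by simp
  have radius: "fps_conv_radius (fps_X * fps_deriv (phi_fps \<nu>)) = \<infinity>"
    using fps_conv_radius_mult[of fps_X "fps_deriv (phi_fps \<nu>)"] deriv_radius by simp
  have "phi_fps \<nu> * bessel_ratio_fps \<nu> = fps_const (- 2) * (fps_X * fps_deriv (phi_fps \<nu>))"
    using phi_fps_log_deriv[OF assms(1)] by (simp add: mult.assoc numeral_fps_const)
  from arg_cong[OF this, of "\<lambda>f. eval_fps f x"] show ?thesis
    using less_fps_conv_radius_bessel_ratio[OF assms]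
    by (simp add: eval_fps_mult phi_fps_conv_radius[OF assms(1)] deriv_radius radius)
qed

text \<open>
On the disc where the logarithmic derivative converges, \<open>F = exp L\<close> with
\<open>L' = - H / (2 X)\<close>. In other words, the disc of radius \<open>\<nu>\<close> contains no zero of \<open>\<phi>\<close> but
the origin.
\<close>

lemma eval_phi_fps_nonzero:
  assumes "\<nu> > 0" "norm x < \<nu>\<^sup>2"
  shows "eval_fps (phi_fps \<nu>) x \<noteq> 0"
proof -
  define L where "L = Abs_fps (\<lambda>k. - fps_nth (bessel_ratio_fps \<nu>) k / (2 * of_nat k) :: complex)"
  let ?F = "phi_fps \<nu>"
  \<comment> \<open>The constant term of the series vanishes, so the default value of the division by 0 is harmless.\<close>
  have H_eq: "bessel_ratio_fps \<nu> = - 2 * (fps_X * fps_deriv L)"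
  proof (rule fps_ext)
    fix k
    show "fps_nth (bessel_ratio_fps \<nu>) k = fps_nth (- 2 * (fps_X * fps_deriv L)) k"
      by (cases k) (simp_all add: L_def numeral_fps_const field_simps del: of_nat_Suc)
  qed
  have "- 2 * fps_X * fps_deriv ?F = - 2 * fps_X * (?F * fps_deriv L)"
    using phi_fps_log_deriv[OF assms(1)] unfolding H_eq by (simp add: mult_ac)
  then have deriv_F: "fps_deriv ?F = ?F * fps_deriv L"
    by simp
  have L_radius: "fps_conv_radius L \<ge> ereal (\<nu>\<^sup>2)"
  proof (rule fps_conv_radius_ge_bessel_ratio[OF assms(1)])
    fix k
    have h: "fps_nth (bessel_ratio_fps \<nu>) k \<ge> (0::real)"
      by (rule bessel_ratio_fps_nth_nonneg[OF assms(1)])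
    have "norm (fps_nth L k) = fps_nth (bessel_ratio_fps \<nu>) k / real (2 * k)"
      using h unfolding L_def fps_nth_Abs_fps
      by (subst bessel_ratio_fps_nth) (simp add: norm_divide norm_mult)
    also have "\<dots> \<le> fps_nth (bessel_ratio_fps \<nu>) k"
      using h mult_left_mono[OF _ h, of 1 "real (2 * k)"]
      by (cases "k = 0") (auto simp: divide_le_eq)
    finally show "norm (fps_nth L k) \<le> fps_nth (bessel_ratio_fps \<nu>) k" .
  qed
  \<comment> \<open>A zero of \<open>F\<close> would be a zero of this product, which is constant with value 1.\<close>
  define E where "E y = eval_fps ?F y * exp (- eval_fps L y)" for y
  have "E y = E 0" if "y \<in> ball 0 (\<nu>\<^sup>2)" for y
  proof (rule has_field_derivative_zero_constant[THEN exE])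
    show "convex (ball (0::complex) (\<nu>\<^sup>2))" by simp
    fix y :: complex assume "y \<in> ball 0 (\<nu>\<^sup>2)"
    then have y: "ereal (norm y) < fps_conv_radius L"
      by (intro less_le_trans[OF _ L_radius]) auto
    then have y': "ereal (norm y) < fps_conv_radius (fps_deriv L)"
      by (rule less_le_trans[OF _ fps_conv_radius_deriv])
    have "(E has_field_derivative
        eval_fps (fps_deriv ?F) y * exp (- eval_fps L y)
          + exp (- eval_fps L y) * (- eval_fps (fps_deriv L) y) * eval_fps ?F y) (at y)"
      unfolding E_def using y
      by (auto intro!: derivative_eq_intros has_field_derivative_eval_fps
               simp: phi_fps_conv_radius[OF assms(1)])
    moreover have "eval_fps (fps_deriv ?F) y = eval_fps ?F y * eval_fps (fps_deriv L) y"
      unfolding deriv_F using y' by (simp add: eval_fps_mult phi_fps_conv_radius[OF assms(1)])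
    ultimately show "(E has_field_derivative 0) (at y within ball 0 (\<nu>\<^sup>2))"
      by (auto intro: has_field_derivative_at_within simp: mult_ac)
  next
    fix c assume "\<forall>y\<in>ball 0 (\<nu>\<^sup>2). E y = c"
    then show "E y = E 0" using that assms(1) by auto
  qed
  then have "E x = E 0" using assms(2) by simp
  also have "E 0 = 1" by (simp add: E_def eval_fps_at_0 L_def)
  finally show ?thesis by (auto simp: E_def)
qed

lemma starlike_quotient_phi:
  assumes "\<nu> > 0" "norm z < \<nu>"
  shows "starlike_quotient (phi \<nu>) z = 1 - eval_fps (bessel_ratio_fps \<nu>) (z\<^sup>2)"
proof (cases "z = 0")
  case True
  then show ?thesis by (simp add: starlike_quotient_def eval_fps_at_0)
next
  case False
  let ?F = "eval_fps (phi_fps \<nu>)" and ?F' = "eval_fps (fps_deriv (phi_fps \<nu>))"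
  have norm_z2: "norm (z\<^sup>2) < \<nu>\<^sup>2"
    using assms by (simp add: norm_power power_strict_mono)
  have "((\<lambda>z. z * ?F (z\<^sup>2)) has_field_derivative ?F (z\<^sup>2) + ?F' (z\<^sup>2) * (2 * z) * z) (at z)"
    by (auto intro!: derivative_eq_intros DERIV_chain2[OF has_field_derivative_eval_fps]
             simp: phi_fps_conv_radius[OF assms(1)])
  then have "deriv (phi \<nu>) z = ?F (z\<^sup>2) + ?F' (z\<^sup>2) * (2 * z) * z"
    unfolding phi_eq_eval_fps[abs_def] by (rule DERIV_imp_deriv)
  also have "\<dots> = ?F (z\<^sup>2) * (1 - eval_fps (bessel_ratio_fps \<nu>) (z\<^sup>2))"
    using eval_phi_fps_log_deriv[OF assms(1) norm_z2]
    by (simp add: algebra_simps power2_eq_square)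
  finally show ?thesis
    using False eval_phi_fps_nonzero[OF assms(1) norm_z2]
    by (simp add: starlike_quotient_def phi_eq_eval_fps)
qed

text \<open>
On \<open>|z| < \<nu>\<close> the quotient is \<open>1 - H(z\<^sup>2)\<close>, whose real part is at least \<open>1 - H(|z|\<^sup>2)\<close> with
equality for real \<open>z\<close>. As \<open>H\<close> increases on the positive axis, the real part is positive for
\<open>|z| < R\<close>, and it vanishes at \<open>z = R\<close>.
\<close>

lemma starlike_radius_phi_eqI:
  assumes "0 < R" "R < \<nu>" "eval_fps (bessel_ratio_fps \<nu>) (R\<^sup>2) = (1::real)"
  shows "starlike_radius (phi \<nu>) = R"
proof -
  have \<nu>: "\<nu> > 0" using assms by simp
  have in_disc: "(z \<noteq> 0 \<longrightarrow> phi \<nu> z \<noteq> 0) \<and> Re (starlike_quotient (phi \<nu>) z) > 0"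
    if "norm z < R" for z
  proof
    have z: "norm z < \<nu>" "norm (z\<^sup>2) < \<nu>\<^sup>2"
      using that assms by (simp_all add: norm_power power_strict_mono)
    show "z \<noteq> 0 \<longrightarrow> phi \<nu> z \<noteq> 0"
      using eval_phi_fps_nonzero[OF \<nu> z(2)] by (simp add: phi_eq_eval_fps)
    have "(norm z)\<^sup>2 < R\<^sup>2" "R\<^sup>2 < \<nu>\<^sup>2"
      using that assms by (simp_all add: power_strict_mono)
    then have "0 < (R\<^sup>2 - (norm z)\<^sup>2) / (2 * (\<nu> + 1))" "(norm z)\<^sup>2 \<le> R\<^sup>2" "R\<^sup>2 < \<nu>\<^sup>2"
      using \<nu> by auto
    then have "eval_fps (bessel_ratio_fps \<nu>) ((norm z)\<^sup>2) < (1::real)"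
      using eval_bessel_ratio_diff_ge[OF \<nu>, of "(norm z)\<^sup>2" "R\<^sup>2"] assms(3) by simp
    then have "norm (eval_fps (bessel_ratio_fps \<nu>) (z\<^sup>2)) < 1"
      using norm_eval_bessel_ratio_le[OF \<nu> z(2)] by (simp add: norm_power)
    then show "Re (starlike_quotient (phi \<nu>) z) > 0"
      using complex_Re_le_cmod[of "eval_fps (bessel_ratio_fps \<nu>) (z\<^sup>2)"]
      by (simp add: starlike_quotient_phi[OF \<nu> z(1)])
  qed
  have "(of_real R)\<^sup>2 = (of_real (R\<^sup>2) :: complex)" by simp
  then have at_R: "Re (starlike_quotient (phi \<nu>) (of_real R)) = 0"
    using assms power_strict_mono[of R \<nu> 2]
    by (simp add: starlike_quotient_phi eval_bessel_ratio_of_real del: of_real_power)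
  have "{r. r > 0 \<and> (\<forall>z\<in>ball 0 r. (z \<noteq> 0 \<longrightarrow> phi \<nu> z \<noteq> 0)
      \<and> Re (starlike_quotient (phi \<nu>) z) > 0)} = {0<..R}" (is "?S = _")
  proof (intro set_eqI iffI)
    fix r assume r: "r \<in> ?S"
    have "r \<le> R"
    proof (rule ccontr)
      assume "\<not> r \<le> R"
      then have "of_real R \<in> ball (0::complex) r" using assms(1) by simp
      with r at_R show False by fastforce
    qed
    with r show "r \<in> {0<..R}" by simp
  qed (use in_disc in auto)
  then show ?thesis
    using assms(1) by (simp add: starlike_radius_def)
qed

text \<open>
The linear term of \<open>H\<close> is \<open>x / (2 (\<nu> + 1))\<close>, so \<open>H\<close> reaches the value 1 no later than at
\<open>x = 2 (\<nu> + 1)\<close>. For \<open>\<nu> \<ge> 3\<close> this point lies inside the disc of convergence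
\<open>|x| < \<nu>\<^sup>2\<close>.
\<close>

lemma starlike_radius_phi_equation:
  assumes "\<nu> \<ge> 3"
  obtains t where "t > 0" "t \<le> 1 + 1 / \<nu>"
    "starlike_radius (phi \<nu>) = sqrt (2 * \<nu> * t)"
    "eval_fps (bessel_ratio_fps \<nu>) (2 * \<nu> * t) = (1::real)"
proof -
  have \<nu>: "\<nu> > 0" using assms by simp
  define b where "b = 2 * (\<nu> + 1)"
  have b: "0 < b" "b < \<nu>\<^sup>2"
  proof -
    have "3 * \<nu> \<le> \<nu>\<^sup>2"
      unfolding power2_eq_square using assms by (intro mult_right_mono) auto
    with assms show "0 < b" "b < \<nu>\<^sup>2" by (auto simp: b_def intro: less_le_trans)
  qed
  let ?h = "eval_fps (bessel_ratio_fps \<nu>) :: real \<Rightarrow> real"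
  have h0: "?h 0 = 0" by (simp add: eval_fps_at_0)
  have h1: "?h b \<ge> 1"
    using eval_bessel_ratio_diff_ge[OF \<nu>, of 0 b] b h0 by (simp add: b_def)
  have "ereal x < fps_conv_radius (bessel_ratio_fps \<nu> :: real fps)" if "0 \<le> x" "x \<le> b" for x
    using less_fps_conv_radius_bessel_ratio[OF \<nu>, of x] that b by simp
  then have "continuous_on {0..b} ?h"
    by (intro continuous_on_eval_fps' continuous_on_id) auto
  then obtain x where x: "0 \<le> x" "x \<le> b" "?h x = 1"
    using IVT'[of ?h 0 1 b] h0 h1 b by auto
  with h0 have x0: "x > 0" by (cases "x = 0") auto
  show ?thesis
  proof (rule that[of "x / (2 * \<nu>)"])
    show "x / (2 * \<nu>) > 0" using x0 \<nu> by simp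
    show "x / (2 * \<nu>) \<le> 1 + 1 / \<nu>" using x(2) \<nu> by (simp add: b_def field_simps)
    have "sqrt x < \<nu>"
      using x(2) b(2) \<nu> by (intro real_less_lsqrt) auto
    then have "starlike_radius (phi \<nu>) = sqrt x"
      using x x0 by (intro starlike_radius_phi_eqI) auto
    then show "starlike_radius (phi \<nu>) = sqrt (2 * \<nu> * (x / (2 * \<nu>)))"
      using \<nu> by simp
    show "?h (2 * \<nu> * (x / (2 * \<nu>))) = 1" using x(3) \<nu> by simp
  qed
qed

section \<open>Truncated asymptotic expansions\<close>

text \<open>
The function \<open>f\<close> agrees with the formal series \<open>A\<close> in powers of \<open>1 / \<nu>\<close> up to an error
\<open>O(\<nu>^(-N))\<close>. A polynomial that is prescribed only modulo \<open>X^N\<close> is used instead of the partial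
sum of \<open>A\<close>, because a product of polynomials needs no truncation; the closure under
multiplication is then immediate.
\<close>

definition asymp_expansion :: "nat \<Rightarrow> (real \<Rightarrow> real) \<Rightarrow> real fps \<Rightarrow> bool" where
  "asymp_expansion N f A \<longleftrightarrow>
     (\<exists>p. (\<forall>k<N. poly.coeff p k = fps_nth A k) \<and>
          (\<lambda>\<nu>. f \<nu> - poly p (1 / \<nu>)) \<in> O[at_top](\<lambda>\<nu>. 1 / \<nu> ^ N))"

lemma asymp_expansion_cong:
  assumes "asymp_expansion N f A" "\<And>k. k < N \<Longrightarrow> fps_nth A k = fps_nth B k"
  shows "asymp_expansion N f B"
  using assms unfolding asymp_expansion_def by metis

lemma asymp_expansion_poly: "asymp_expansion N (\<lambda>\<nu>. poly p (1 / \<nu>)) (fps_of_poly p)"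
  unfolding asymp_expansion_def by (intro exI[of _ p]) auto

lemma asymp_expansion_const: "asymp_expansion N (\<lambda>_. c) (fps_const c)"
  using asymp_expansion_poly[of N "[:c:]"] by (simp add: fps_of_poly_pCons)

lemma asymp_expansion_inverse: "asymp_expansion N (\<lambda>\<nu>. 1 / \<nu>) fps_X"
  using asymp_expansion_poly[of N "[:0, 1:]"] by (simp add: fps_of_poly_pCons)

definition fps_partial_sum :: "nat \<Rightarrow> real fps \<Rightarrow> real \<Rightarrow> real" where
  "fps_partial_sum N A \<nu> = (\<Sum>k<N. fps_nth A k / \<nu> ^ k)"

lemma fps_partial_sum_eq_poly:
  "fps_partial_sum N A \<nu> = poly (\<Sum>k<N. monom (fps_nth A k) k) (1 / \<nu>)"
  by (simp add: fps_partial_sum_def poly_sum poly_monom power_divide)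

lemma coeff_sum_monom:
  "k < N \<Longrightarrow> poly.coeff (\<Sum>k<N. monom (a k) k) k = a k"
  by (simp add: coeff_sum)

lemma asymp_expansion_partial_sum: "asymp_expansion N (fps_partial_sum N A) A"
  unfolding fps_partial_sum_eq_poly[abs_def]
  by (rule asymp_expansion_cong[OF asymp_expansion_poly]) (simp add: coeff_sum_monom)

lemma tendsto_poly_inverse: "((\<lambda>\<nu>. poly p (1 / \<nu>)) \<longlongrightarrow> poly p 0) at_top"
  for p :: "real poly"
  by (intro tendsto_intros tendsto_divide_0[OF tendsto_const] filterlim_at_top_imp_at_infinity
      filterlim_ident)

lemma tendsto_fps_partial_sum:
  assumes "N \<ge> 1"
  shows "(fps_partial_sum N A \<longlongrightarrow> fps_nth A 0) at_top"
  using tendsto_poly_inverse[of "\<Sum>k<N. monom (fps_nth A k) k"] coeff_sum_monom[of 0 N "fps_nth A"] assms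
  by (simp add: fps_partial_sum_eq_poly[abs_def] poly_0_coeff_0)

lemma inverse_power_bigo_1: "(\<lambda>\<nu>::real. 1 / \<nu> ^ N) \<in> O[at_top](\<lambda>_. 1)"
  using tendsto_poly_inverse[of "monom 1 N"]
  by (intro bigoI_tendsto[where c = "poly (monom 1 N) 0"]) (simp_all add: poly_monom power_divide)

lemma poly_inverse_bigo_1: "(\<lambda>\<nu>. poly p (1 / \<nu>)) \<in> O[at_top](\<lambda>_. 1)" for p :: "real poly"
  using tendsto_poly_inverse[of p] by (intro bigoI_tendsto[where c = "poly p 0"]) simp_all

lemma asymp_expansion_bigo_1:
  assumes "asymp_expansion N f A"
  shows "f \<in> O[at_top](\<lambda>_. 1)"
proof -
  obtain p where "(\<lambda>\<nu>. f \<nu> - poly p (1 / \<nu>)) \<in> O[at_top](\<lambda>\<nu>. 1 / \<nu> ^ N)"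
    using assms by (auto simp: asymp_expansion_def)
  then have "(\<lambda>\<nu>. f \<nu> - poly p (1 / \<nu>)) \<in> O[at_top](\<lambda>_. 1)"
    using inverse_power_bigo_1 by (rule landau_o.big_trans)
  from sum_in_bigo(1)[OF this poly_inverse_bigo_1[of p]] show ?thesis by simp
qed

lemma asymp_expansion_add:
  assumes "asymp_expansion N f A" "asymp_expansion N g B"
  shows "asymp_expansion N (\<lambda>\<nu>. f \<nu> + g \<nu>) (A + B)"
proof -
  obtain p q where pq: "\<forall>k<N. poly.coeff p k = fps_nth A k" "\<forall>k<N. poly.coeff q k = fps_nth B k"
    "(\<lambda>\<nu>. f \<nu> - poly p (1 / \<nu>)) \<in> O[at_top](\<lambda>\<nu>. 1 / \<nu> ^ N)"
    "(\<lambda>\<nu>. g \<nu> - poly q (1 / \<nu>)) \<in> O[at_top](\<lambda>\<nu>. 1 / \<nu> ^ N)"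
    using assms by (auto simp: asymp_expansion_def)
  from sum_in_bigo(1)[OF pq(3,4)] show ?thesis
    unfolding asymp_expansion_def using pq(1,2)
    by (intro exI[of _ "p + q"]) (simp add: algebra_simps)
qed

lemma asymp_expansion_mult:
  assumes "asymp_expansion N f A" "asymp_expansion N g B"
  shows "asymp_expansion N (\<lambda>\<nu>. f \<nu> * g \<nu>) (A * B)"
proof -
  obtain p q where pq: "\<forall>k<N. poly.coeff p k = fps_nth A k" "\<forall>k<N. poly.coeff q k = fps_nth B k"
    "(\<lambda>\<nu>. f \<nu> - poly p (1 / \<nu>)) \<in> O[at_top](\<lambda>\<nu>. 1 / \<nu> ^ N)"
    "(\<lambda>\<nu>. g \<nu> - poly q (1 / \<nu>)) \<in> O[at_top](\<lambda>\<nu>. 1 / \<nu> ^ N)"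
    using assms by (auto simp: asymp_expansion_def)
  have "(\<lambda>\<nu>. (f \<nu> - poly p (1 / \<nu>)) * g \<nu>) \<in> O[at_top](\<lambda>\<nu>. 1 / \<nu> ^ N)"
    using landau_o.big.mult[OF pq(3) asymp_expansion_bigo_1[OF assms(2)]] by simp
  moreover have "(\<lambda>\<nu>. poly p (1 / \<nu>) * (g \<nu> - poly q (1 / \<nu>))) \<in> O[at_top](\<lambda>\<nu>. 1 / \<nu> ^ N)"
    using landau_o.big.mult[OF poly_inverse_bigo_1 pq(4)] by simp
  ultimately have "(\<lambda>\<nu>. (f \<nu> - poly p (1 / \<nu>)) * g \<nu> + poly p (1 / \<nu>) * (g \<nu> - poly q (1 / \<nu>)))
      \<in> O[at_top](\<lambda>\<nu>. 1 / \<nu> ^ N)"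
    by (rule sum_in_bigo(1))
  moreover have "poly.coeff (p * q) k = fps_nth (A * B) k" if "k < N" for k
    using that pq(1,2) by (auto simp: coeff_mult fps_mult_nth atLeast0AtMost intro!: sum.cong)
  ultimately show ?thesis
    unfolding asymp_expansion_def
    by (intro exI[of _ "p * q"]) (simp add: algebra_simps)
qed

lemma asymp_expansion_sum:
  assumes "\<And>i. i \<in> I \<Longrightarrow> asymp_expansion N (f i) (A i)"
  shows "asymp_expansion N (\<lambda>\<nu>. \<Sum>i\<in>I. f i \<nu>) (\<Sum>i\<in>I. A i)"
  using assms asymp_expansion_const[of N 0]
  by (induction I rule: infinite_finite_induct) (auto intro: asymp_expansion_add)

lemma asymp_expansion_power:
  assumes "asymp_expansion N f A"
  shows "asymp_expansion N (\<lambda>\<nu>. f \<nu> ^ n) (A ^ n)"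
  using assms asymp_expansion_const[of N 1]
  by (induction n) (auto intro: asymp_expansion_mult)

lemma asymp_expansion_geometric:
  assumes "c \<ge> 0"
  shows "asymp_expansion N (\<lambda>\<nu>. 1 / (1 + c * (1 / \<nu>))) (Abs_fps (\<lambda>m. (- c) ^ m))"
proof -
  let ?S = "fps_partial_sum N (Abs_fps (\<lambda>m. (- c) ^ m))"
  have "(\<lambda>\<nu>. 1 / (1 + c * (1 / \<nu>)) - ?S \<nu>) \<in> O[at_top](\<lambda>\<nu>. 1 / \<nu> ^ N)"
  proof (rule bigoI[of _ "c ^ N"], rule eventually_mono[OF eventually_gt_at_top[of 0]])
    fix \<nu> :: real assume \<nu>: "\<nu> > 0"
    define q where "q = c * (1 / \<nu>)"
    have q: "q \<ge> 0" using assms \<nu> by (simp add: q_def)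
    have "?S \<nu> = (\<Sum>k<N. (- q) ^ k)"
      by (simp add: fps_partial_sum_def q_def flip: power_divide)
    also have "\<dots> = (1 - (- q) ^ N) / (1 + q)"
      using q geometric_sum[of "- q" N] by (simp add: field_simps)
    finally have "1 / (1 + q) - ?S \<nu> = (- q) ^ N / (1 + q)"
      by (simp add: diff_divide_distrib)
    then have "norm (1 / (1 + q) - ?S \<nu>) = q ^ N / (1 + q)"
      using q by (simp add: power_abs)
    also have "\<dots> \<le> q ^ N / 1"
      using q by (intro divide_left_mono) auto
    finally show "norm (1 / (1 + c * (1 / \<nu>)) - ?S \<nu>) \<le> c ^ N * norm (1 / \<nu> ^ N)"
      using \<nu> by (simp add: q_def power_divide power_mult_distrib)
  qed
  then show ?thesis
    unfolding asymp_expansion_def fps_partial_sum_eq_poly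
    by (intro exI conjI) (auto simp: coeff_sum_monom)
qed

text \<open>
Two polynomials with the same coefficients below \<open>N\<close> differ by a multiple of \<open>X^N\<close>, so
the choice of the polynomial in the definition of \<open>asymp_expansion\<close> is immaterial.
\<close>

lemma asymp_expansion_unique_fun:
  assumes "asymp_expansion N f A" "asymp_expansion N g A"
  shows "(\<lambda>\<nu>. f \<nu> - g \<nu>) \<in> O[at_top](\<lambda>\<nu>. 1 / \<nu> ^ N)"
proof -
  obtain p q where pq: "\<forall>k<N. poly.coeff p k = fps_nth A k" "\<forall>k<N. poly.coeff q k = fps_nth A k"
    "(\<lambda>\<nu>. f \<nu> - poly p (1 / \<nu>)) \<in> O[at_top](\<lambda>\<nu>. 1 / \<nu> ^ N)"
    "(\<lambda>\<nu>. g \<nu> - poly q (1 / \<nu>)) \<in> O[at_top](\<lambda>\<nu>. 1 / \<nu> ^ N)"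
    using assms by (auto simp: asymp_expansion_def)
  have "monom 1 N dvd p - q"
    using pq(1,2) by (simp add: monom_1_dvd_iff')
  then obtain r where r: "p - q = monom 1 N * r" by (elim dvdE)
  have "(\<lambda>\<nu>. 1 / \<nu> ^ N * poly r (1 / \<nu>)) \<in> O[at_top](\<lambda>\<nu>. 1 / \<nu> ^ N)"
    using landau_o.big.mult[OF landau_o.big_refl[of "\<lambda>\<nu>. 1 / \<nu> ^ N"] poly_inverse_bigo_1[of r]]
    by simp
  moreover have "poly p (1 / \<nu>) - poly q (1 / \<nu>) = 1 / \<nu> ^ N * poly r (1 / \<nu>)" for \<nu>
    using arg_cong[OF r, of "\<lambda>p. poly p (1 / \<nu>)"] by (simp add: poly_monom power_divide)
  ultimately have "(\<lambda>\<nu>. poly p (1 / \<nu>) - poly q (1 / \<nu>)) \<in> O[at_top](\<lambda>\<nu>. 1 / \<nu> ^ N)" by simp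
  from sum_in_bigo(1)[OF sum_in_bigo(2)[OF pq(3,4)] this] show ?thesis
    by (simp add: algebra_simps)
qed

lemma asymp_expansionI_diff:
  assumes "asymp_expansion N g A" "(\<lambda>\<nu>. f \<nu> - g \<nu>) \<in> O[at_top](\<lambda>\<nu>. 1 / \<nu> ^ N)"
  shows "asymp_expansion N f A"
proof -
  obtain p where p: "\<forall>k<N. poly.coeff p k = fps_nth A k"
    "(\<lambda>\<nu>. g \<nu> - poly p (1 / \<nu>)) \<in> O[at_top](\<lambda>\<nu>. 1 / \<nu> ^ N)"
    using assms by (auto simp: asymp_expansion_def)
  from sum_in_bigo(1)[OF assms(2) p(2)] p(1) show ?thesis
    unfolding asymp_expansion_def by (intro exI[of _ p]) simp
qed

section \<open>The formal radius equation\<close>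

lemma sigma_fps_1: "Abs_fps (sigma 1) = fps_const (1 / 4) * Abs_fps (\<lambda>m. (- 1) ^ m)"
  by (rule fps_ext) (simp add: sigma.simps[of "Suc 0"])

text \<open>
The triple sum defining \<open>sigma\<close> is the Rayleigh recurrence with \<open>1 / (1 + k e)\<close> expanded
into a geometric series.
\<close>

lemma sigma_fps_recurrence:
  assumes "k \<ge> 2"
  shows "Abs_fps (sigma k) =
    (\<Sum>n=1..<k. Abs_fps (sigma n) * Abs_fps (sigma (k - n))) * Abs_fps (\<lambda>m. (- real k) ^ m)"
proof (rule fps_ext)
  fix m
  have "sigma k m = (\<Sum>i=0..m. \<Sum>j=0..i. \<Sum>n=1..<k.
      (- real k) ^ (m - i) * sigma n j * sigma (k - n) (i - j))"
    using assms by (subst sigma.simps) simp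
  also have "\<dots> = (\<Sum>i=0..m. (\<Sum>n=1..<k. \<Sum>j=0..i. sigma n j * sigma (k - n) (i - j))
      * (- real k) ^ (m - i))"
    by (subst sum.swap) (simp add: sum_distrib_left sum_distrib_right mult_ac)
  finally show "fps_nth (Abs_fps (sigma k)) m = fps_nth
      ((\<Sum>n=1..<k. Abs_fps (sigma n) * Abs_fps (sigma (k - n))) * Abs_fps (\<lambda>m. (- real k) ^ m)) m"
    by (simp add: fps_mult_nth fps_sum_nth)
qed

lemma asymp_expansion_rayleigh_coeff:
  assumes "k \<ge> 1"
  shows "asymp_expansion N (\<lambda>\<nu>. rayleigh_coeff (1 / \<nu>) k) (Abs_fps (sigma k))"
  using assms
proof (induction k rule: less_induct)
  case (less k)
  show ?case
  proof (cases "k = 1")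
    case True
    have "asymp_expansion N (\<lambda>\<nu>. 1 / 4 * (1 / (1 + 1 * (1 / \<nu>)))) (Abs_fps (sigma 1))"
      unfolding sigma_fps_1
      by (intro asymp_expansion_mult asymp_expansion_const asymp_expansion_geometric) simp
    then show ?thesis by (simp add: True rayleigh_coeff_1)
  next
    case False
    then have "k \<ge> 2" using less.prems by simp
    have "asymp_expansion N
        (\<lambda>\<nu>. (\<Sum>n=1..<k. rayleigh_coeff (1 / \<nu>) n * rayleigh_coeff (1 / \<nu>) (k - n))
          * (1 / (1 + real k * (1 / \<nu>)))) (Abs_fps (sigma k))"
      unfolding sigma_fps_recurrence[OF \<open>k \<ge> 2\<close>]
      by (intro asymp_expansion_mult asymp_expansion_sum asymp_expansion_geometric less.IH) auto
    moreover have "rayleigh_coeff (1 / \<nu>) k =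
        (\<Sum>n=1..<k. rayleigh_coeff (1 / \<nu>) n * rayleigh_coeff (1 / \<nu>) (k - n))
          * (1 / (1 + real k * (1 / \<nu>)))" for \<nu>
      using False by (subst rayleigh_coeff.simps) simp
    ultimately show ?thesis by simp
  qed
qed

definition rho_fps :: "real fps" where
  "rho_fps = 1 + Abs_fps (\<lambda>i. if i = 0 then 0 else rho i)"

lemma rho_fps_nth: "fps_nth rho_fps k = (if k = 0 then 1 else rho k)"
  by (simp add: rho_fps_def)

text \<open>
The potential polynomials are the coefficients of the powers of \<open>rho_fps\<close>, so the inner sum is
a convolution.
\<close>

lemma rho_recurrence:
  "rho k = (- 1) ^ (k + 1) - (\<Sum>n=1..<k. (- 1) ^ (k - n) * rho n)
    - (\<Sum>n=2..k + 1. 2 ^ (n + 1) * fps_nth (Abs_fps (sigma n) * rho_fps ^ n) (k + 1 - n))"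
proof -
  have "(\<Sum>m=0..k + 1 - n. sigma n (k + 1 - n - m) * potential_poly (real n) m (\<lambda>i. rho i))
      = fps_nth (Abs_fps (sigma n) * rho_fps ^ n) (k + 1 - n)" for n
    unfolding potential_poly_of_nat mult.commute[of "Abs_fps (sigma n)"] fps_mult_nth
    by (simp add: rho_fps_def mult.commute)
  then show ?thesis by (subst rho.simps) (simp only:)
qed

text \<open>
The formal expansion of \<open>H(2 \<nu> t)\<close> in powers of \<open>e = 1 / \<nu>\<close> when \<open>t\<close> is replaced by
the series \<open>1 + \<Sum> rho k e^k\<close>. The term \<open>n\<close> is divisible by \<open>e^(n-1)\<close>, so the terms up to
\<open>N\<close> determine the coefficients below \<open>N\<close>.
\<close>

definition radius_equation_fps :: "nat \<Rightarrow> real fps" where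
  "radius_equation_fps N =
    (\<Sum>n=1..N. fps_const (2 ^ (n + 1)) * (fps_X ^ (n - 1) * (Abs_fps (sigma n) * rho_fps ^ n)))"

text \<open>
The recurrence for \<open>rho\<close> says exactly that the radius equation \<open>H(2 \<nu> t) = 1\<close> holds
formally.
\<close>

lemma radius_equation_fps_nth:
  assumes "k < N"
  shows "fps_nth (radius_equation_fps N) k = (if k = 0 then 1 else 0)"
proof -
  let ?c = "\<lambda>n. 2 ^ (n + 1) * fps_nth (Abs_fps (sigma n) * rho_fps ^ n) (k + 1 - n)"
  have "fps_nth (radius_equation_fps N) k = (\<Sum>n=1..N. if k + 1 < n then 0 else ?c n)"
    unfolding radius_equation_fps_def fps_sum_nth
  proof (rule sum.cong)
    fix n assume "n \<in> {1..N}"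
    then show "fps_nth (fps_const (2 ^ (n + 1)) * (fps_X ^ (n - 1) * (Abs_fps (sigma n) * rho_fps ^ n))) k
        = (if k + 1 < n then 0 else ?c n)"
      by (cases n) (auto simp: fps_X_power_mult_nth)
  qed simp
  also have "\<dots> = (\<Sum>n=1..k + 1. ?c n)"
    using assms by (intro sum.mono_neutral_cong_right) auto
  also have "\<dots> = ?c 1 + (\<Sum>n=2..k + 1. ?c n)"
    by (subst sum.atLeast_Suc_atMost) (simp_all add: numeral_2_eq_2)
  also have "?c 1 = (\<Sum>n\<le>k. (- 1) ^ (k - n) * fps_nth rho_fps n)"
    by (subst mult.commute[of "Abs_fps (sigma 1)"])
       (simp add: fps_mult_nth atLeast0AtMost sigma.simps[of "Suc 0"] sum_distrib_left mult_ac)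
  finally have nth: "fps_nth (radius_equation_fps N) k =
      (\<Sum>n\<le>k. (- 1) ^ (k - n) * fps_nth rho_fps n) + (\<Sum>n=2..k + 1. ?c n)" .
  show ?thesis
  proof (cases "k = 0")
    case True
    with nth show ?thesis by (simp add: rho_fps_nth)
  next
    case False
    have "{..k} = insert 0 (insert k {1..<k})" using False by auto
    with False have "(\<Sum>n\<le>k. (- 1) ^ (k - n) * fps_nth rho_fps n) =
        (- 1) ^ k + (rho k + (\<Sum>n=1..<k. (- 1) ^ (k - n) * rho n))"
      by (simp add: rho_fps_nth)
    with False rho_recurrence[of k] nth show ?thesis by simp
  qed
qed

definition pi_fps :: "real fps" where
  "pi_fps = Abs_fps (\<lambda>k. if k = 0 then 1 else pi_coeff k)"

lemma pi_fps_square: "pi_fps\<^sup>2 = rho_fps"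
proof (rule fps_ext)
  fix k
  show "fps_nth (pi_fps\<^sup>2) k = fps_nth rho_fps k"
  proof (cases "k = 0")
    case True
    then show ?thesis by (simp add: pi_fps_def rho_fps_nth power2_eq_square)
  next
    case False
    have "{0..k} = insert 0 (insert k {1..<k})" using False by auto
    with False have "fps_nth (pi_fps\<^sup>2) k =
        2 * pi_coeff k + (\<Sum>n=1..<k. pi_coeff n * pi_coeff (k - n))"
      by (simp add: pi_fps_def power2_eq_square fps_mult_nth)
    moreover have "2 * pi_coeff k = rho k - (\<Sum>n=1..<k. pi_coeff n * pi_coeff (k - n))"
      by (subst pi_coeff.simps) simp
    ultimately show ?thesis using False by (simp add: rho_fps_nth)
  qed
qed

section \<open>Asymptotics of the radius\<close>

text \<open>
The Taylor polynomial of degree \<open>N\<close> of \<open>t \<mapsto> H(2 \<nu> t)\<close>, with the powers of \<open>\<nu>\<close>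
collected.
\<close>

definition truncated_ratio :: "nat \<Rightarrow> real \<Rightarrow> real \<Rightarrow> real" where
  "truncated_ratio N \<nu> t =
    (\<Sum>n=1..N. 2 ^ (n + 1) * ((1 / \<nu>) ^ (n - 1) * (rayleigh_coeff (1 / \<nu>) n * t ^ n)))"

lemma asymp_expansion_truncated_ratio:
  assumes "asymp_expansion N t rho_fps"
  shows "asymp_expansion N (\<lambda>\<nu>. truncated_ratio N \<nu> (t \<nu>)) 1"
proof (rule asymp_expansion_cong)
  show "asymp_expansion N (\<lambda>\<nu>. truncated_ratio N \<nu> (t \<nu>)) (radius_equation_fps N)"
    unfolding truncated_ratio_def radius_equation_fps_def
    by (intro asymp_expansion_sum asymp_expansion_mult asymp_expansion_power asymp_expansion_const
        asymp_expansion_inverse asymp_expansion_rayleigh_coeff assms) auto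
qed (simp add: radius_equation_fps_nth)

text \<open>
The linear term has slope \<open>1 / (1 + 1 / \<nu>) \<ge> 1 / 2\<close> and the other terms increase. So an
approximate solution of the radius equation is close to the exact one, with the same order of
error.
\<close>

lemma truncated_ratio_diff_ge:
  assumes "N \<ge> 1" "\<nu> \<ge> 1" "0 \<le> t" "t \<le> u"
  shows "truncated_ratio N \<nu> u - truncated_ratio N \<nu> t \<ge> (u - t) / 2"
proof -
  define d where "d n = 2 ^ (n + 1) * ((1 / \<nu>) ^ (n - 1) * (rayleigh_coeff (1 / \<nu>) n * u ^ n))
    - 2 ^ (n + 1) * ((1 / \<nu>) ^ (n - 1) * (rayleigh_coeff (1 / \<nu>) n * t ^ n))" for n
  have "d n \<ge> 0" for n
    unfolding d_def using assms
    by (auto intro!: mult_left_mono power_mono rayleigh_coeff_nonneg)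
  then have "d 1 \<le> sum d {1..N}"
    using assms(1) by (intro member_le_sum) auto
  moreover have "(u - t) / 2 \<le> (u - t) / (1 + 1 / \<nu>)"
    using assms by (intro divide_left_mono) (auto simp: field_simps)
  moreover have "4 * rayleigh_coeff (1 / \<nu>) 1 = 1 / (1 + 1 / \<nu>)"
    unfolding One_nat_def rayleigh_coeff_1 using mult_divide_mult_cancel_left[of 4 1 "1 + 1 / \<nu>"]
    by (simp only: times_divide_eq_right)
  then have "d 1 = (u - t) / (1 + 1 / \<nu>)"
    by (simp add: d_def diff_divide_distrib del: One_nat_def flip: mult.assoc)
  moreover have "truncated_ratio N \<nu> u - truncated_ratio N \<nu> t = sum d {1..N}"
    by (simp add: truncated_ratio_def d_def sum_subtractf)
  ultimately show ?thesis
    by linarith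
qed

lemma truncated_ratio_diff_abs_ge:
  assumes "N \<ge> 1" "\<nu> \<ge> 1" "0 \<le> t" "0 \<le> u"
  shows "\<bar>u - t\<bar> \<le> 2 * \<bar>truncated_ratio N \<nu> u - truncated_ratio N \<nu> t\<bar>"
  using truncated_ratio_diff_ge[OF assms(1,2), of t u] truncated_ratio_diff_ge[OF assms(1,2), of u t]
    assms(3,4) by (cases "t \<le> u") auto

text \<open>
With \<open>y = 2 t / \<nu>\<close> the tail is \<open>2 \<nu> \<Sum> rayleigh_coeff k y^k\<close> over \<open>k > N\<close>, hence at most
\<open>\<nu> y^(N+1)\<close> because the coefficients have sum at most \<open>1 / 2\<close>.
\<close>

lemma truncated_ratio_tail:
  assumes "\<nu> \<ge> 3" "0 \<le> t" "t \<le> 1 + 1 / \<nu>"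
  shows "\<bar>eval_fps (bessel_ratio_fps \<nu>) (2 * \<nu> * t) - truncated_ratio N \<nu> t\<bar> \<le> 3 ^ (N + 1) * (1 / \<nu> ^ N)"
proof -
  let ?s = "rayleigh_coeff (1 / \<nu>)"
  define y where "y = 2 * t / \<nu>"
  have \<nu>: "\<nu> > 0" using assms by simp
  \<comment> \<open>As \<open>t \<le> 4 / 3\<close>, the argument \<open>y\<close> stays in the unit interval, where the coefficient bound applies.\<close>
  have "1 / \<nu> \<le> 1 / 3" using assms(1) by (intro divide_left_mono) auto
  then have t: "2 * t \<le> 3" using assms(3) by simp
  then have y: "0 \<le> y" "y \<le> 1" using assms(1,2) by (auto simp: y_def divide_le_eq)
  have nonneg: "?s k \<ge> 0" for k using \<nu> by (intro rayleigh_coeff_nonneg) simp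
  have summable_s: "summable ?s" using \<nu> by (intro summable_rayleigh_coeff) simp
  have summable: "summable (\<lambda>k. 2 * \<nu> * (?s k * y ^ k))"
    using nonneg y
    by (intro summable_mult summable_comparison_test'[OF summable_s])
       (auto simp: abs_mult power_le_one mult_left_le)
  have term_eq: "fps_nth (bessel_ratio_fps \<nu>) k * (2 * \<nu> * t) ^ k = 2 * \<nu> * (?s k * y ^ k)" for k
    using \<nu> by (simp add: bessel_ratio_fps_def y_def power_mult power_mult_distrib power_divide
      power2_eq_square field_simps)
  have "truncated_ratio N \<nu> t = (\<Sum>k=1..N. 2 * \<nu> * (?s k * y ^ k))"
    unfolding truncated_ratio_def
  proof (rule sum.cong)
    fix n assume "n \<in> {1..N}"
    then show "2 ^ (n + 1) * ((1 / \<nu>) ^ (n - 1) * (?s n * t ^ n)) = 2 * \<nu> * (?s n * y ^ n)"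
      using \<nu> by (cases n) (simp_all add: y_def power_divide power_mult_distrib)
  qed simp
  also have "\<dots> = (\<Sum>k<N + 1. 2 * \<nu> * (?s k * y ^ k))"
    by (rule sum.mono_neutral_left) (auto simp: Suc_le_eq)
  finally have "eval_fps (bessel_ratio_fps \<nu>) (2 * \<nu> * t) - truncated_ratio N \<nu> t
      = (\<Sum>k. 2 * \<nu> * (?s (k + (N + 1)) * y ^ (k + (N + 1))))"
    unfolding eval_fps_def term_eq using suminf_split_initial_segment[OF summable, of "N + 1"]
    by simp
  moreover have "0 \<le> (\<Sum>k. 2 * \<nu> * (?s (k + (N + 1)) * y ^ (k + (N + 1))))"
    using \<nu> y nonneg by (intro suminf_nonneg summable_ignore_initial_segment[OF summable]) simp
  moreover have "(\<Sum>k. 2 * \<nu> * (?s (k + (N + 1)) * y ^ (k + (N + 1))))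
      \<le> (\<Sum>k. 2 * \<nu> * y ^ (N + 1) * ?s (k + (N + 1)))"
  proof (rule suminf_le)
    show "summable (\<lambda>k. 2 * \<nu> * (?s (k + (N + 1)) * y ^ (k + (N + 1))))"
      by (rule summable_ignore_initial_segment[OF summable])
    show "summable (\<lambda>k. 2 * \<nu> * y ^ (N + 1) * ?s (k + (N + 1)))"
      by (intro summable_mult summable_ignore_initial_segment[OF summable_s])
    fix k
    have "y ^ (k + (N + 1)) \<le> y ^ (N + 1)"
      using y by (intro power_decreasing) auto
    then have "2 * \<nu> * ?s (k + (N + 1)) * y ^ (k + (N + 1)) \<le> 2 * \<nu> * ?s (k + (N + 1)) * y ^ (N + 1)"
      using \<nu> nonneg by (intro mult_left_mono) auto
    then show "2 * \<nu> * (?s (k + (N + 1)) * y ^ (k + (N + 1))) \<le> 2 * \<nu> * y ^ (N + 1) * ?s (k + (N + 1))"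
      by (simp only: mult_ac)
  qed
  moreover have "(\<Sum>k. 2 * \<nu> * y ^ (N + 1) * ?s (k + (N + 1))) \<le> 2 * \<nu> * y ^ (N + 1) * (1 / 2)"
  proof -
    have "(\<Sum>k. ?s (k + (N + 1))) \<le> (\<Sum>k. ?s k)"
      using suminf_split_initial_segment[OF summable_s, of "N + 1"] nonneg
      by (simp add: sum_nonneg)
    also have "\<dots> \<le> 1 / 2" using \<nu> by (intro suminf_rayleigh_coeff_le) simp
    finally show ?thesis
      using \<nu> y by (subst suminf_mult[OF summable_ignore_initial_segment[OF summable_s]])
        (intro mult_left_mono, auto)
  qed
  moreover have "2 * \<nu> * y ^ (N + 1) * (1 / 2) = (2 * t) ^ (N + 1) * (1 / \<nu> ^ N)"
    using \<nu> by (simp add: y_def power_divide)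
  moreover have "(2 * t) ^ (N + 1) * (1 / \<nu> ^ N) \<le> 3 ^ (N + 1) * (1 / \<nu> ^ N)"
    using t assms(2) \<nu> by (intro mult_right_mono power_mono) auto
  ultimately show ?thesis by linarith
qed

text \<open>
Both \<open>t\<close> and the partial sum of \<open>rho_fps\<close> solve the truncated radius equation up to
\<open>O(\<nu>^(-N))\<close>: the former because only a tail is missing, the latter by
\<open>radius_equation_fps_nth\<close>. The lower bound on the slope turns this into a bound
on their difference.
\<close>

lemma asymp_expansion_radius_square:
  assumes "N \<ge> 1"
    and t: "\<And>\<nu>. \<nu> \<ge> 3 \<Longrightarrow> 0 < t \<nu>" "\<And>\<nu>. \<nu> \<ge> 3 \<Longrightarrow> t \<nu> \<le> 1 + 1 / \<nu>"
      "\<And>\<nu>. \<nu> \<ge> 3 \<Longrightarrow> eval_fps (bessel_ratio_fps \<nu>) (2 * \<nu> * t \<nu>) = (1 :: real)"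
  shows "asymp_expansion N t rho_fps"
proof (rule asymp_expansionI_diff)
  let ?T = "fps_partial_sum N rho_fps" and ?G = "truncated_ratio N"
  show "asymp_expansion N ?T rho_fps" by (rule asymp_expansion_partial_sum)
  have G_T: "(\<lambda>\<nu>. 1 - ?G \<nu> (?T \<nu>)) \<in> O[at_top](\<lambda>\<nu>. 1 / \<nu> ^ N)"
    using asymp_expansion_const[of N 1]
    by (intro asymp_expansion_unique_fun[where A = 1] asymp_expansion_truncated_ratio
        asymp_expansion_partial_sum) simp_all
  have G_t: "(\<lambda>\<nu>. 1 - ?G \<nu> (t \<nu>)) \<in> O[at_top](\<lambda>\<nu>. 1 / \<nu> ^ N)"
  proof (rule bigoI[of _ "3 ^ (N + 1)"], rule eventually_mono[OF eventually_ge_at_top[of 3]])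
    fix \<nu> :: real assume \<nu>: "\<nu> \<ge> 3"
    then show "norm (1 - ?G \<nu> (t \<nu>)) \<le> 3 ^ (N + 1) * norm (1 / \<nu> ^ N)"
      using truncated_ratio_tail[OF \<nu>, of "t \<nu>" N] t[OF \<nu>] by simp
  qed
  have "eventually (\<lambda>\<nu>. ?T \<nu> > 0) at_top"
    using order_tendstoD(1)[OF tendsto_fps_partial_sum[OF assms(1)], of 0 rho_fps]
    by (simp add: rho_fps_nth)
  then have "eventually (\<lambda>\<nu>. norm (t \<nu> - ?T \<nu>)
      \<le> 2 * norm ((1 - ?G \<nu> (?T \<nu>)) - (1 - ?G \<nu> (t \<nu>)))) at_top"
    using eventually_ge_at_top[of 3]
  proof eventually_elim
    case (elim \<nu>)
    then show ?case
      using truncated_ratio_diff_abs_ge[OF assms(1), of \<nu> "?T \<nu>" "t \<nu>"] t(1)[of \<nu>] by simp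
  qed
  then have "(\<lambda>\<nu>. t \<nu> - ?T \<nu>) \<in> O[at_top](\<lambda>\<nu>. (1 - ?G \<nu> (?T \<nu>)) - (1 - ?G \<nu> (t \<nu>)))"
    by (rule bigoI)
  also have "(\<lambda>\<nu>. (1 - ?G \<nu> (?T \<nu>)) - (1 - ?G \<nu> (t \<nu>))) \<in> O[at_top](\<lambda>\<nu>. 1 / \<nu> ^ N)"
    by (rule sum_in_bigo(2)[OF G_T G_t])
  finally show "(\<lambda>\<nu>. t \<nu> - ?T \<nu>) \<in> O[at_top](\<lambda>\<nu>. 1 / \<nu> ^ N)" .
qed

text \<open>
Here \<open>sqrt t - P = (t - P\<^sup>2) / (sqrt t + P)\<close> for the partial sum \<open>P\<close>, and the denominator stays
away from 0.
\<close>

lemma asymp_expansion_sqrt: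
  assumes "N \<ge> 1" "asymp_expansion N t (A\<^sup>2)" "eventually (\<lambda>\<nu>. t \<nu> \<ge> 0) at_top" "fps_nth A 0 = 1"
  shows "(\<lambda>\<nu>. sqrt (t \<nu>) - fps_partial_sum N A \<nu>) \<in> O[at_top](\<lambda>\<nu>. 1 / \<nu> ^ N)"
proof -
  let ?P = "fps_partial_sum N A"
  have "eventually (\<lambda>\<nu>. ?P \<nu> > 1 / 2) at_top"
    using order_tendstoD(1)[OF tendsto_fps_partial_sum[OF assms(1)], of "1 / 2" A] assms(4) by simp
  with assms(3) have "eventually (\<lambda>\<nu>. norm (sqrt (t \<nu>) - ?P \<nu>) \<le> 2 * norm (t \<nu> - (?P \<nu>)\<^sup>2)) at_top"
  proof eventually_elim
    case (elim \<nu>)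
    have "t \<nu> - (?P \<nu>)\<^sup>2 = (sqrt (t \<nu>) - ?P \<nu>) * (sqrt (t \<nu>) + ?P \<nu>)"
      using elim by (simp add: algebra_simps power2_eq_square)
    then have "norm (t \<nu> - (?P \<nu>)\<^sup>2) = \<bar>sqrt (t \<nu>) - ?P \<nu>\<bar> * (sqrt (t \<nu>) + ?P \<nu>)"
      using elim by (simp add: abs_mult)
    moreover have "\<bar>sqrt (t \<nu>) - ?P \<nu>\<bar> * (sqrt (t \<nu>) + ?P \<nu>) \<ge> \<bar>sqrt (t \<nu>) - ?P \<nu>\<bar> * (1 / 2)"
    proof (intro mult_left_mono)
      show "1 / 2 \<le> sqrt (t \<nu>) + ?P \<nu>"
        using elim real_sqrt_ge_zero[of "t \<nu>"] by linarith
    qed simp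
    ultimately show ?case by simp
  qed
  then have "(\<lambda>\<nu>. sqrt (t \<nu>) - ?P \<nu>) \<in> O[at_top](\<lambda>\<nu>. t \<nu> - (?P \<nu>)\<^sup>2)"
    by (rule bigoI)
  also have "(\<lambda>\<nu>. t \<nu> - (?P \<nu>)\<^sup>2) \<in> O[at_top](\<lambda>\<nu>. 1 / \<nu> ^ N)"
    by (intro asymp_expansion_unique_fun[OF assms(2)] asymp_expansion_power asymp_expansion_partial_sum)
  finally show ?thesis .
qed

lemma starlike_radius_phi_asymptotics:
  assumes "N \<ge> 1"
  shows "(\<lambda>\<nu>. starlike_radius (phi \<nu>) / sqrt (2 * \<nu>) - fps_partial_sum N pi_fps \<nu>)
    \<in> O[at_top](\<lambda>\<nu>. 1 / \<nu> ^ N)"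
proof -
  have "\<forall>\<nu>\<ge>3. \<exists>t>0. t \<le> 1 + 1 / \<nu> \<and> starlike_radius (phi \<nu>) = sqrt (2 * \<nu> * t)
      \<and> eval_fps (bessel_ratio_fps \<nu>) (2 * \<nu> * t) = (1 :: real)"
    by (metis starlike_radius_phi_equation)
  then obtain t where t: "\<And>\<nu>. \<nu> \<ge> 3 \<Longrightarrow> 0 < t \<nu> \<and> t \<nu> \<le> 1 + 1 / \<nu>
      \<and> starlike_radius (phi \<nu>) = sqrt (2 * \<nu> * t \<nu>)
      \<and> eval_fps (bessel_ratio_fps \<nu>) (2 * \<nu> * t \<nu>) = (1 :: real)"
    by metis
  have "eventually (\<lambda>\<nu>. t \<nu> \<ge> 0) at_top"
    using eventually_ge_at_top[of 3] by eventually_elim (use t in \<open>auto intro: less_imp_le\<close>)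
  moreover have "asymp_expansion N t (pi_fps\<^sup>2)"
    unfolding pi_fps_square using assms t by (intro asymp_expansion_radius_square) auto
  ultimately have "(\<lambda>\<nu>. sqrt (t \<nu>) - fps_partial_sum N pi_fps \<nu>) \<in> O[at_top](\<lambda>\<nu>. 1 / \<nu> ^ N)"
    using assms by (intro asymp_expansion_sqrt) (auto simp: pi_fps_def)
  moreover have "eventually (\<lambda>\<nu>. starlike_radius (phi \<nu>) / sqrt (2 * \<nu>) - fps_partial_sum N pi_fps \<nu>
      = sqrt (t \<nu>) - fps_partial_sum N pi_fps \<nu>) at_top"
    using eventually_ge_at_top[of 3]
  proof eventually_elim
    case (elim \<nu>)
    then show ?case using t[of \<nu>] by (simp add: real_sqrt_mult)
  qed
  ultimately show ?thesis
    by (subst landau_o.big.in_cong) auto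
qed

lemma fps_partial_sum_pi:
  assumes "N \<ge> 1"
  shows "fps_partial_sum N pi_fps \<nu> = 1 + (\<Sum>k=1..<N. pi_coeff k / \<nu> ^ k)"
proof -
  have "{..<N} = insert 0 {1..<N}" using assms by auto
  then show ?thesis by (simp add: fps_partial_sum_def pi_fps_def)
qed

section \<open>The first coefficients\<close>

lemma small_intervals:
  "{0..1::nat} = {0, 1}" "{0..2::nat} = {0, 1, 2}" "{0..3::nat} = {0, 1, 2, 3}"
  "{1..<2::nat} = {1}" "{1..<3::nat} = {1, 2}" "{1..<4::nat} = {1, 2, 3}" "{1..<5::nat} = {1, 2, 3, 4}"
  "{2..3::nat} = {2, 3}" "{2..4::nat} = {2, 3, 4}" "{2..5::nat} = {2, 3, 4, 5}"
  by auto

lemma sigma_1: "sigma 1 m = (- 1) ^ m / 4"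
  by (subst sigma.simps) simp

lemma sigma_2:
  "sigma 2 0 = 1 / 16" "sigma 2 1 = - 1 / 4" "sigma 2 2 = 11 / 16" "sigma 2 3 = - 13 / 8"
  by (subst sigma.simps, simp add: small_intervals sigma_1 del: One_nat_def)+

lemma sigma_3:
  "sigma 3 0 = 1 / 32" "sigma 3 1 = - 1 / 4" "sigma 3 2 = 5 / 4"
  by (subst sigma.simps, simp add: small_intervals sigma_1 sigma_2 del: One_nat_def)+

lemma sigma_4:
  "sigma 4 0 = 5 / 256" "sigma 4 1 = - 1 / 4"
  by (subst sigma.simps, simp add: small_intervals sigma_1 sigma_2 sigma_3 del: One_nat_def)+

lemma sigma_5:
  "sigma 5 0 = 7 / 512"
  by (subst sigma.simps, simp add: small_intervals sigma_1 sigma_2 sigma_3 sigma_4 del: One_nat_def)+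

lemma rho_values: "rho 1 = 1 / 2" "rho 2 = 1 / 2" "rho 3 = - 1 / 2" "rho 4 = - 1 / 2"
proof -
  note compute = rho_fps_nth fps_mult_nth power2_eq_square power3_eq_cube power4_eq_xxxx
    small_intervals sigma_1 sigma_2 sigma_3 sigma_4 sigma_5
    sigma_2(2)[unfolded One_nat_def] sigma_3(2)[unfolded One_nat_def]
    sigma_4(2)[unfolded One_nat_def] fps_power_zeroth
  show 1: "rho 1 = 1 / 2"
    by (subst rho_recurrence) (simp add: compute del: One_nat_def)
  note compute = compute 1 1[unfolded One_nat_def]
  show 2: "rho 2 = 1 / 2"
    by (subst rho_recurrence) (simp add: compute del: One_nat_def)
  show 3: "rho 3 = - 1 / 2"
    by (subst rho_recurrence) (simp add: compute 2 del: One_nat_def)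
  show "rho 4 = - 1 / 2"
    by (subst rho_recurrence) (simp add: compute 2 3 del: One_nat_def)
qed

lemma pi_coeff_values:
  "pi_coeff 1 = 1 / 4" "pi_coeff 2 = 7 / 32" "pi_coeff 3 = - (39 / 128)" "pi_coeff 4 = - (405 / 2048)"
proof -
  note compute = rho_values rho_values(1)[unfolded One_nat_def] small_intervals
  show 1: "pi_coeff 1 = 1 / 4"
    by (subst pi_coeff.simps) (simp add: compute del: One_nat_def)
  note compute = compute 1 1[unfolded One_nat_def]
  show 2: "pi_coeff 2 = 7 / 32"
    by (subst pi_coeff.simps) (simp add: compute del: One_nat_def)
  show 3: "pi_coeff 3 = - (39 / 128)"
    by (subst pi_coeff.simps) (simp add: compute 2 del: One_nat_def)
  show "pi_coeff 4 = - (405 / 2048)"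
    by (subst pi_coeff.simps) (simp add: compute 2 3 del: One_nat_def)
qed

section \<open>The expansion of the radius of starlikeness\<close>

theorem corollary1:
  shows "(\<forall>N\<ge>1. (\<lambda>\<nu>::real. starlike_radius (phi \<nu>) / sqrt (2 * \<nu>)
              - (1 + (\<Sum>k=1..<N. pi_coeff k / \<nu> ^ k)))
            \<in> O[at_top](\<lambda>\<nu>. 1 / \<nu> ^ N))
         \<and> pi_coeff 1 = 1 / 4 \<and> pi_coeff 2 = 7 / 32
         \<and> pi_coeff 3 = - (39 / 128) \<and> pi_coeff 4 = - (405 / 2048)"
  using starlike_radius_phi_asymptotics fps_partial_sum_pi pi_coeff_values by simp

end
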